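(* Let $\emptyset\neq G\subset\mathbb{R}^n$ be a bounded open set, $0<s,\alpha<1$ and $1<p<\infty$. Fix an $\alpha$-Hölder function $R$ on $G$, with Hölder constant $L$, such that $0\le R(x)\le\operatorname{dist}(x,\partial G)$ for every $x\in G$. Then, if $0<\sigma<\alpha s$, there exists a constant $C=C(\sigma,s,\alpha,n,p,L,\operatorname{diam}(G))>0$, depending only on the indicated quantities, such that $$|M_R(f)|_{W^{\sigma,p}(G)}\le C\,|f|_{W^{s,p}(G)}$$ holds for every $f\in L^p(G)$.
   Context: A function $R:G\to\mathbb{R}$ is $\alpha$-Hölder on $G$ if there exists $L\ge0$ (a Hölder constant) such that $|R(x)-R(y)|\le L|x-y|^\alpha$ for all $x,y\in G$. $B(x,r)$ is the open ball of center $x$ and radius $r$. For $f\in L^1_{\mathrm{loc}}(G)$ and $x\in G$, $$M_R(f)(x)=\sup_{0\le r\le R(x)}\frac{1}{|B(x,r)|}\int_{B(x,r)}|f(y)|\,dy,$$ where for $r=0$ the average is by convention equal to $|f(x)|$. For $0<t<1$, the fractional Sobolev seminorm is $$|f|_{W^{t,p}(G)}=\Big(\int_G\int_G\frac{|f(x)-f(y)|^p}{|x-y|^{n+tp}}\,dy\,dx\Big)^{1/p}.$$ *)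

theory Defs
  imports "HOL-Analysis.Analysis"
begin

definition holder_on :: "real \<Rightarrow> real \<Rightarrow> ('a::real_normed_vector \<Rightarrow> real) \<Rightarrow> 'a set \<Rightarrow> bool" where
  "holder_on \<alpha> L R G \<longleftrightarrow>
     0 \<le> L \<and> (\<forall>x\<in>G. \<forall>y\<in>G. \<bar>R x - R y\<bar> \<le> L * norm (x - y) powr \<alpha>)"

text \<open>The space \<open>L\<^sup>p(G)\<close> for \<open>1 \<le> p < \<infinity>\<close>, as a set of pointwise representatives. Elements are total
  functions, but their values outside \<open>G\<close> play no role.\<close>

definition Lp_on :: "real \<Rightarrow> 'a::euclidean_space set \<Rightarrow> ('a \<Rightarrow> real) set" where
  "Lp_on p G = {f. f \<in> borel_measurable (lebesgue_on G) \<and>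
                   integrable (lebesgue_on G) (\<lambda>x. \<bar>f x\<bar> powr p)}"

text \<open>Powers of extended nonnegative reals, for exponents \<open>q > 0\<close> only.\<close>

definition epowr :: "ennreal \<Rightarrow> real \<Rightarrow> ennreal" where
  "epowr a q = (if a = \<infinity> then \<infinity> else ennreal (enn2real a powr q))"

text \<open>The radius-zero average is \<open>\<bar>f x\<bar>\<close> by convention.\<close>

definition ball_average :: "('a::euclidean_space \<Rightarrow> real) \<Rightarrow> 'a \<Rightarrow> real \<Rightarrow> ennreal" where
  "ball_average f x r =
     (if r = 0 then ennreal \<bar>f x\<bar>
      else (\<integral>\<^sup>+ y \<in> ball x r. ennreal \<bar>f y\<bar> \<partial>lebesgue) / emeasure lebesgue (ball x r))"

definition local_maximal :: "('a::euclidean_space \<Rightarrow> real) \<Rightarrow> ('a \<Rightarrow> real) \<Rightarrow> 'a \<Rightarrow> ereal" where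
  "local_maximal R f x = enn2ereal (SUP r\<in>{0..R x}. ball_average f x r)"

text \<open>The fractional seminorm is defined for extended real functions, because the maximal function
  may take the value \<open>\<infinity>\<close> at some points. Since \<open>\<infinity> - \<infinity> = \<infinity>\<close> in \<^typ>\<open>ereal\<close>, infinite
  values can only enlarge the seminorm. The diagonal \<open>y = x\<close> is a null set for each \<open>x\<close>, so the value
  of the quotient there is irrelevant.\<close>

definition frac_seminorm :: "'a::euclidean_space set \<Rightarrow> real \<Rightarrow> real \<Rightarrow> ('a \<Rightarrow> ereal) \<Rightarrow> ennreal" where
  "frac_seminorm G t p F =
     epowr (\<integral>\<^sup>+ x \<in> G. (\<integral>\<^sup>+ y \<in> G.
              epowr (e2ennreal \<bar>F x - F y\<bar>) p
                / ennreal (norm (x - y) powr (real DIM('a) + t * p)) \<partial>lebesgue) \<partial>lebesgue)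
       (1 / p)"

end

theory Submission
  imports Defs
begin

text \<open>
  Let \<open>g(u)\<^sup>p = \<integral>\<^sub>G |f u - f w|\<^sup>p / |u - w|\<^bsup>n+sp\<^esup> dw\<close>. If a ball of radius \<open>\<tau>\<close> inside \<open>G\<close> is
  within distance comparable to \<open>\<tau>\<close> of both \<open>u\<close> and \<open>v\<close>, averaging over the intermediate points of
  that ball gives \<open>|f u - f v| \<le> C \<tau>\<^sup>s (g u + g v)\<close>. Writing the average of \<open>|f|\<close> over \<open>B(x,r)\<close> as a
  mean over \<open>z \<in> B(0,1)\<close> of \<open>|f (x + r z)|\<close>, this compares averages over different balls, with an error
  controlled by averages of \<open>g\<^sup>p\<close>. These are at most \<open>r\<^bsup>-\<kappa>\<^esup>\<close> times the Riesz potential of \<open>g\<^sup>p\<close> of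
  order \<open>\<kappa>\<close>, whose integral over the bounded set \<open>G\<close> is at most a multiple of \<open>\<integral>\<^sub>G g\<^sup>p\<close>; the room
  between \<open>\<sigma>\<close> and \<open>\<alpha> s\<close> pays for the loss \<open>r\<^bsup>-\<kappa>\<^esup>\<close>, so that no maximal theorem is needed.
  For \<open>|x - y| = \<delta>\<close> and \<open>\<theta> = \<Lambda> \<delta>\<^sup>\<alpha>\<close>, a ball \<open>B(x,r)\<close> with \<open>r \<le> 2\<theta>\<close> is compared with the points \<open>x\<close>
  and then \<open>y\<close>, while a larger one is shrunk to the radius \<open>r' = min r (R y)\<close> and then moved to \<open>B(y,r')\<close>.
\<close>

subsection \<open>Powers and integrals\<close>

lemma epowr_ennreal: "0 \<le> a \<Longrightarrow> epowr (ennreal a) q = ennreal (a powr q)"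
  by (simp add: epowr_def)

lemma epowr_top [simp]: "epowr top q = top"
  by (simp add: epowr_def)

lemma epowr_mono:
  assumes "0 \<le> q" "a \<le> b"
  shows "epowr a q \<le> epowr b q"
proof (cases b rule: ennreal_cases)
  case (real b')
  then obtain a' where "a = ennreal a'" "0 \<le> a'"
    using assms(2) by (cases a rule: ennreal_cases) (auto simp: top_unique)
  then show ?thesis
    using real assms by (simp add: epowr_ennreal powr_mono2)
qed simp

lemma epowr_cmult:
  assumes "0 < c"
  shows "epowr (ennreal c * a) q = ennreal (c powr q) * epowr a q"
proof (cases a rule: ennreal_cases)
  case (real a')
  then have "epowr (ennreal c * a) q = epowr (ennreal (c * a')) q"
    using assms by (simp add: ennreal_mult)
  then show ?thesis
    using real assms by (simp add: epowr_ennreal powr_mult flip: ennreal_mult)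
qed (use assms in \<open>simp add: ennreal_mult_top\<close>)

lemma epowr_epowr_inverse:
  assumes "q \<noteq> 0"
  shows "epowr (epowr a (1 / q)) q = a"
  by (cases a rule: ennreal_cases) (use assms in \<open>simp_all add: epowr_ennreal powr_powr\<close>)

text \<open>The sum is at most twice the maximum, whose power is one of the two powers on the right;
  convexity is avoided.\<close>

lemma powr_add_le:
  fixes a b p :: real
  assumes "0 \<le> a" "0 \<le> b" "0 \<le> p"
  shows "(a + b) powr p \<le> 2 powr p * (a powr p + b powr p)"
proof -
  have "(a + b) powr p \<le> (2 * max a b) powr p"
    using assms by (intro powr_mono2) auto
  also have "\<dots> = 2 powr p * (max a b) powr p"
    using assms by (simp add: powr_mult)
  also have "\<dots> \<le> 2 powr p * (a powr p + b powr p)"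
    by (intro mult_left_mono) (auto simp: max_def)
  finally show ?thesis .
qed

section \<open>Lebesgue measure: Fubini and affine substitution\<close>

lemma sigma_finite_lebesgue: "sigma_finite_measure (lebesgue :: 'a::euclidean_space measure)"
proof
  show "\<exists>A::'a set set. countable A \<and> A \<subseteq> sets lebesgue \<and> \<Union>A = space lebesgue \<and> (\<forall>a\<in>A. emeasure lebesgue a \<noteq> \<infinity>)"
  proof (intro exI[of _ "range (\<lambda>n::nat. cball 0 (real n))"] conjI ballI)
    show "\<Union>(range (\<lambda>n::nat. cball (0::'a) (real n))) = space lebesgue"
      by (auto simp: real_arch_simple)
    show "emeasure lebesgue a \<noteq> \<infinity>" if "a \<in> range (\<lambda>n::nat. cball (0::'a) (real n))" for a
      using that by (auto simp: emeasure_cball)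
  qed auto
qed

lemma pair_sigma_finite_lebesgue:
  "pair_sigma_finite (lebesgue :: 'a::euclidean_space measure) (lebesgue :: 'b::euclidean_space measure)"
  by (simp add: pair_sigma_finite_def sigma_finite_lebesgue)

lemmas lebesgue_Fubini' = pair_sigma_finite.Fubini'[OF pair_sigma_finite_lebesgue]

lemma nn_integral_lebesgue_affine:
  fixes h :: "'a::euclidean_space \<Rightarrow> ennreal"
  assumes [measurable]: "h \<in> borel_measurable lebesgue" and "0 < r"
  shows "(\<integral>\<^sup>+ y. h y \<partial>lebesgue) = ennreal (r ^ DIM('a)) * (\<integral>\<^sup>+ z. h (x + r *\<^sub>R z) \<partial>lebesgue)"
proof -
  \<comment> \<open>The dilation is written coordinatewise because
    \<open>lebesgue_affine_euclidean\<close> and \<open>lebesgue_affine_measurable\<close> are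
    stated in that form.\<close>
  define T where "T = (\<lambda>z::'a. x + (\<Sum>j\<in>Basis. (r * (z \<bullet> j)) *\<^sub>R j))"
  have T: "T z = x + r *\<^sub>R z" for z
    unfolding T_def by (simp add: euclidean_representation flip: scaleR_scaleR scaleR_sum_right)
  have [measurable]: "T \<in> lebesgue \<rightarrow>\<^sub>M lebesgue"
    unfolding T_def using \<open>0 < r\<close> by (intro lebesgue_affine_measurable) auto
  have "lebesgue = density (distr lebesgue lebesgue T) (\<lambda>_. ennreal (r ^ DIM('a)))"
    using lebesgue_affine_euclidean[of "\<lambda>_. r" x] \<open>0 < r\<close> by (simp add: T_def)
  then have "(\<integral>\<^sup>+ y. h y \<partial>lebesgue) = (\<integral>\<^sup>+ y. h y \<partial>density (distr lebesgue lebesgue T) (\<lambda>_. ennreal (r ^ DIM('a))))"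
    by simp
  also have "\<dots> = ennreal (r ^ DIM('a)) * (\<integral>\<^sup>+ z. h (T z) \<partial>lebesgue)"
    by (simp add: nn_integral_density nn_integral_distr nn_integral_cmult)
  finally show ?thesis
    by (simp add: T)
qed

text \<open>Lebesgue measurability can be lost under composition with a continuous map. For r
  \<noteq> 0 the map is an invertible affine one; for r = 0 the composite is constant.\<close>

lemma measurable_lebesgue_affine:
  fixes x :: "'a::euclidean_space"
  assumes "h \<in> lebesgue \<rightarrow>\<^sub>M N"
  shows "(\<lambda>z. h (x + r *\<^sub>R z)) \<in> lebesgue \<rightarrow>\<^sub>M N"
proof (cases "r = 0")
  case True
  then show ?thesis
    using measurable_space[OF assms, of x] by simp
next
  case False
  define T where "T = (\<lambda>z::'a. x + (\<Sum>j\<in>Basis. (r * (z \<bullet> j)) *\<^sub>R j))"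
  have T: "T z = x + r *\<^sub>R z" for z
    unfolding T_def by (simp add: euclidean_representation flip: scaleR_scaleR scaleR_sum_right)
  have "T \<in> lebesgue \<rightarrow>\<^sub>M lebesgue"
    unfolding T_def using False by (intro lebesgue_affine_measurable) auto
  from measurable_compose[OF this assms] show ?thesis
    by (simp add: T)
qed

text \<open>The kernel is compared with a geometric series of indicators of the balls of radii \<open>d / 2\<^sup>k\<close>.\<close>

lemma nn_integral_norm_powr_cball_le:
  fixes d \<beta> :: real
  assumes "0 < d" "0 < \<beta>"
  shows "\<exists>K\<ge>0. \<forall>w::'a::euclidean_space.
    (\<integral>\<^sup>+ x\<in>cball w d. ennreal (norm (x - w) powr (\<beta> - DIM('a))) \<partial>lebesgue) \<le> ennreal K"
proof -
  define n where "n = real DIM('a)"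
  define a where "a = \<beta> - n"
  define \<omega> where "\<omega> = unit_ball_vol n"
  define \<rho> where "\<rho> k = d / 2 ^ k" for k :: nat
  have \<rho>: "0 < \<rho> k" for k
    using assms by (simp add: \<rho>_def)
  have \<omega>: "0 \<le> \<omega>"
    by (simp add: \<omega>_def n_def)
  \<comment> \<open>For \<open>\<rho> (Suc k) < t\<close> and \<open>t \<le> \<rho> k\<close> the
    powers of exponent \<open>a\<close> of \<open>t\<close> and \<open>\<rho> k\<close> differ by at
    most this factor, whatever the sign of \<open>a\<close>.\<close>
  define c where "c = 2 powr \<bar>a\<bar>"
  have shell: "ennreal (norm (x - w) powr a) * indicator (cball w d) x
      \<le> (\<Sum>k. ennreal (c * \<rho> k powr a) * indicator (cball w (\<rho> k)) x)" for x w :: 'a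
  \<comment> \<open>At x = w the left side vanishes because \<open>0 powr a = 0\<close>.\<close>
  proof (cases "x \<in> cball w d \<and> x \<noteq> w")
    case True
    define t where "t = norm (x - w)"
    have t: "0 < t" "t \<le> d"
      using True by (auto simp: t_def dist_norm norm_minus_commute)
    \<comment> \<open>The index of the dyadic shell containing x; the single term of index
      \<open>k\<close> already dominates the kernel.\<close>
    define k where "k = (LEAST k. \<rho> (Suc k) < t)"
    have "\<exists>k. \<rho> (Suc k) < t"
    proof -
      obtain k where "(1/2) ^ k < t / d"
        using real_arch_pow_inv[of "t / d" "1/2"] t assms by auto
      then have "\<rho> k < t"
        using assms by (simp add: \<rho>_def field_simps)
      moreover have "\<rho> (Suc k) \<le> \<rho> k"
        using \<rho>[of k] by (simp add: \<rho>_def)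
      ultimately show ?thesis
        by (meson le_less_trans)
    qed
    then have k1: "\<rho> (Suc k) < t"
      unfolding k_def by (rule LeastI_ex)
    have k2: "t \<le> \<rho> k"
    proof (cases k)
      case 0
      then show ?thesis
        using t by (simp add: \<rho>_def)
    next
      case (Suc j)
      then show ?thesis
        using not_less_Least[of j "\<lambda>k. \<rho> (Suc k) < t"] by (simp add: k_def)
    qed
    have "t powr a \<le> c * \<rho> k powr a"
    proof (cases "0 \<le> a")
      case True
      have "t powr a \<le> 1 * \<rho> k powr a"
        using t k2 True by (simp add: powr_mono2)
      also have "\<dots> \<le> c * \<rho> k powr a"
        using True by (intro mult_right_mono) (auto simp: c_def ge_one_powr_ge_zero)
      finally show ?thesis .
    next
      case False
      have "t powr a \<le> (\<rho> k / 2) powr a"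
        using False k1 \<rho>[of k] by (intro powr_mono2') (auto simp: \<rho>_def)
      also have "\<dots> = c * \<rho> k powr a"
        using False \<rho>[of k] by (simp add: powr_divide c_def powr_minus field_simps)
      finally show ?thesis .
    qed
    then have "ennreal (norm (x - w) powr a) * indicator (cball w d) x
        \<le> ennreal (c * \<rho> k powr a) * indicator (cball w (\<rho> k)) x"
      using True k2 by (auto simp: t_def dist_norm norm_minus_commute ennreal_leI)
    also have "\<dots> = (\<Sum>k\<in>{k}. ennreal (c * \<rho> k powr a) * indicator (cball w (\<rho> k)) x)"
      by (simp only: sum.insert finite.emptyI sum.empty empty_iff add_0_right not_False_eq_True)
    also have "\<dots> \<le> (\<Sum>k. ennreal (c * \<rho> k powr a) * indicator (cball w (\<rho> k)) x)"
      by (rule sum_le_suminf) auto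
    finally show ?thesis .
  qed auto
  \<comment> \<open>The volume of the k-th ball raises the exponent from \<beta> - n to \<beta>, so
    the terms become geometric with this ratio, which is below 1 because \<beta> > 0.\<close>
  define q where "q = 2 powr (- \<beta>)"
  have q: "0 \<le> q" "q < 1"
    using assms powr_less_mono[of "-\<beta>" 0 2] by (auto simp: q_def)
  have "(\<integral>\<^sup>+ x\<in>cball w d. ennreal (norm (x - w) powr a) \<partial>lebesgue)
      \<le> ennreal (c * \<omega> * d powr \<beta> * (1 / (1 - q)))" for w :: 'a
  proof -
    have "(\<integral>\<^sup>+ x\<in>cball w d. ennreal (norm (x - w) powr a) \<partial>lebesgue)
       \<le> (\<integral>\<^sup>+ x. (\<Sum>k. ennreal (c * \<rho> k powr a) * indicator (cball w (\<rho> k)) x) \<partial>lebesgue)"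
      by (intro nn_integral_mono shell)
    also have "\<dots> = (\<Sum>k. \<integral>\<^sup>+ x. ennreal (c * \<rho> k powr a) * indicator (cball w (\<rho> k)) x \<partial>lebesgue)"
      by (rule nn_integral_suminf) (intro borel_measurable_times_ennreal borel_measurable_indicator, simp_all)
    also have "\<dots> = (\<Sum>k. ennreal (c * \<omega> * d powr \<beta> * q ^ k))"
    proof (intro suminf_cong)
      fix k
      have "(\<integral>\<^sup>+ x. ennreal (c * \<rho> k powr a) * indicator (cball w (\<rho> k)) x \<partial>lebesgue)
          = ennreal (c * \<rho> k powr a) * ennreal (\<omega> * \<rho> k powr n)"
        using \<rho>[of k] by (simp add: nn_integral_cmult_indicator emeasure_cball \<omega>_def n_def powr_realpow)
      also have "\<dots> = ennreal (c * \<omega> * \<rho> k powr \<beta>)"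
        using \<omega> by (subst ennreal_mult[symmetric]) (auto simp: c_def a_def powr_diff \<rho> less_imp_neq[OF \<rho>, symmetric])
      also have "\<rho> k powr \<beta> = d powr \<beta> * q ^ k"
      proof -
        have "(2 ^ k) powr \<beta> = (2 powr \<beta>) ^ k"
          by (simp add: powr_power mult.commute powr_powr flip: powr_realpow[of 2 k])
        then show ?thesis
          using assms by (simp add: \<rho>_def powr_divide q_def powr_minus power_inverse field_simps)
      qed
      finally show "(\<integral>\<^sup>+ x. ennreal (c * \<rho> k powr a) * indicator (cball w (\<rho> k)) x \<partial>lebesgue)
          = ennreal (c * \<omega> * d powr \<beta> * q ^ k)"
        by (simp add: mult.assoc)
    qed
    also have "\<dots> = ennreal (c * \<omega> * d powr \<beta> * (1 / (1 - q)))"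
      by (rule suminf_ennreal_eq[OF _ sums_mult[OF geometric_sums]]) (use q \<omega> in \<open>simp_all add: c_def\<close>)
    finally show ?thesis .
  qed
  moreover have "0 \<le> c * \<omega> * d powr \<beta> * (1 / (1 - q))"
    using q \<omega> by (simp add: c_def)
  ultimately show ?thesis
    unfolding a_def n_def by blast
qed

subsection \<open>The Gagliardo density and its Riesz potential\<close>

text \<open>Kept as the p-th power g^p, so that its integral over \<open>G\<close> is the p-th power
  of the seminorm.\<close>

definition gagliardo :: "'a::euclidean_space set \<Rightarrow> real \<Rightarrow> real \<Rightarrow> ('a \<Rightarrow> real) \<Rightarrow> 'a \<Rightarrow> ennreal" where
  "gagliardo G s p f u =
     (\<integral>\<^sup>+ w\<in>G. ennreal (\<bar>f u - f w\<bar> powr p / norm (u - w) powr (real DIM('a) + s * p)) \<partial>lebesgue)"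

text \<open>The usual normalising constant is omitted. Since \<open>0 powr\<close> any exponent is
  0, the kernel vanishes at w = x instead of blowing up.\<close>

definition riesz_potential :: "'a::euclidean_space set \<Rightarrow> real \<Rightarrow> ('a \<Rightarrow> ennreal) \<Rightarrow> 'a \<Rightarrow> ennreal" where
  "riesz_potential G \<kappa> h x =
     (\<integral>\<^sup>+ w\<in>G. h w * ennreal (norm (x - w) powr (\<kappa> - real DIM('a))) \<partial>lebesgue)"

text \<open>The two terms serve the two kinds of radius: at r = 0 the mean of the density is its
  value at x, while for r > 0 the mean is controlled by the potential.\<close>

definition energy :: "'a::euclidean_space set \<Rightarrow> real \<Rightarrow> real \<Rightarrow> real \<Rightarrow> ('a \<Rightarrow> real) \<Rightarrow> 'a \<Rightarrow> ennreal" where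
  "energy G s p \<kappa> f x = gagliardo G s p f x + riesz_potential G \<kappa> (gagliardo G s p f) x"

section \<open>Measurability of kernels and potentials\<close>

lemma measurable_lebesgue_pair_diff [measurable]:
  "(\<lambda>z. fst z - snd z) \<in> borel_measurable (lebesgue \<Otimes>\<^sub>M (lebesgue :: 'a::euclidean_space measure))"
proof -
  have "fst \<in> (lebesgue :: 'a measure) \<Otimes>\<^sub>M (lebesgue :: 'a measure) \<rightarrow>\<^sub>M borel"
    by (rule measurable_compose[OF measurable_fst]) (simp add: measurable_completion)
  moreover have "snd \<in> (lebesgue :: 'a measure) \<Otimes>\<^sub>M (lebesgue :: 'a measure) \<rightarrow>\<^sub>M borel"
    by (rule measurable_compose[OF measurable_snd]) (simp add: measurable_completion)
  ultimately show ?thesis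
    by (rule borel_measurable_diff)
qed

lemma measurable_norm_diff_pair [measurable]:
  "(\<lambda>z. norm (fst z - snd z) powr a) \<in> borel_measurable (lebesgue \<Otimes>\<^sub>M (lebesgue :: 'a::euclidean_space measure))"
  by measurable

lemma measurable_gagliardo_kernel:
  fixes f :: "'a::euclidean_space \<Rightarrow> real"
  assumes [measurable]: "f \<in> borel_measurable lebesgue"
  shows "(\<lambda>z. \<bar>f (fst z) - f (snd z)\<bar> powr p / norm (fst z - snd z) powr a)
    \<in> borel_measurable (lebesgue \<Otimes>\<^sub>M lebesgue)"
  by measurable

lemma measurable_gagliardo [measurable]:
  fixes f :: "'a::euclidean_space \<Rightarrow> real"
  assumes [measurable]: "f \<in> borel_measurable lebesgue" "G \<in> sets lebesgue"
  shows "gagliardo G s p f \<in> borel_measurable lebesgue"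
  unfolding gagliardo_def
  using measurable_gagliardo_kernel[OF assms(1), of p "real DIM('a) + s * p"]
  by (intro sigma_finite_measure.borel_measurable_nn_integral[OF sigma_finite_lebesgue])
    (simp add: case_prod_beta')

lemma measurable_riesz_potential [measurable]:
  fixes h :: "'a::euclidean_space \<Rightarrow> ennreal"
  assumes [measurable]: "h \<in> borel_measurable lebesgue" "G \<in> sets lebesgue"
  shows "riesz_potential G \<kappa> h \<in> borel_measurable lebesgue"
  unfolding riesz_potential_def
  using measurable_norm_diff_pair[of "\<kappa> - real DIM('a)", where ?'a = 'a]
  by (intro sigma_finite_measure.borel_measurable_nn_integral[OF sigma_finite_lebesgue])
    (simp add: case_prod_beta')

lemma measurable_energy [measurable]:
  fixes f :: "'a::euclidean_space \<Rightarrow> real"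
  assumes [measurable]: "f \<in> borel_measurable lebesgue" "G \<in> sets lebesgue"
  shows "energy G s p \<kappa> f \<in> borel_measurable lebesgue"
  unfolding energy_def by measurable

text \<open>Such a \<open>G\<close> lies in \<open>cball w d\<close>. The bound \<open>K\<close> is
  chosen before \<open>G\<close> and \<open>w\<close>; this uniformity is what lets the final
  constant depend on \<open>G\<close> through its diameter only.\<close>

lemma nn_integral_riesz_kernel_le:
  fixes G :: "'a::euclidean_space set" and d \<beta> :: real
  assumes "0 < d" "0 < \<beta>"
  shows "\<exists>K\<ge>0. \<forall>(G :: 'a set) w. (\<forall>x\<in>G. dist w x \<le> d) \<longrightarrow>
    (\<integral>\<^sup>+ x\<in>G. ennreal (norm (x - w) powr (\<beta> - real DIM('a))) \<partial>lebesgue) \<le> ennreal K"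
proof -
  obtain K where "0 \<le> K" and K: "(\<integral>\<^sup>+ x\<in>cball w d. ennreal (norm (x - w) powr (\<beta> - real DIM('a))) \<partial>lebesgue) \<le> ennreal K" for w :: 'a
    using nn_integral_norm_powr_cball_le[OF assms, where ?'a = 'a] by blast
  have "(\<integral>\<^sup>+ x\<in>G. ennreal (norm (x - w) powr (\<beta> - real DIM('a))) \<partial>lebesgue) \<le> ennreal K"
    if "\<forall>x\<in>G. dist w x \<le> d" for G and w :: 'a
    by (rule order_trans[OF nn_integral_mono K[of w]]) (use that in \<open>auto simp: indicator_def\<close>)
  with \<open>0 \<le> K\<close> show ?thesis
    by blast
qed

text \<open>After exchanging the integrals the kernel is integrated in x first, where the uniform
  bound applies. This L^1 estimate takes the place of a maximal theorem.\<close>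

lemma nn_integral_riesz_potential_le:
  fixes d \<kappa> :: real
  assumes "0 < d" "0 < \<kappa>"
  shows "\<exists>K\<ge>0. \<forall>(G :: 'a::euclidean_space set) h. G \<in> sets lebesgue \<longrightarrow> h \<in> borel_measurable lebesgue \<longrightarrow>
    (\<forall>x\<in>G. \<forall>y\<in>G. dist x y \<le> d) \<longrightarrow>
    (\<integral>\<^sup>+ x\<in>G. riesz_potential G \<kappa> h x \<partial>lebesgue) \<le> ennreal K * (\<integral>\<^sup>+ w\<in>G. h w \<partial>lebesgue)"
proof -
  obtain K where "0 \<le> K" and K: "\<And>(G :: 'a set) w. (\<forall>x\<in>G. dist w x \<le> d) \<Longrightarrow>
    (\<integral>\<^sup>+ x\<in>G. ennreal (norm (x - w) powr (\<kappa> - real DIM('a))) \<partial>lebesgue) \<le> ennreal K"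
    using nn_integral_riesz_kernel_le[OF assms, where ?'a = 'a] by blast
  have "(\<integral>\<^sup>+ x\<in>G. riesz_potential G \<kappa> h x \<partial>lebesgue) \<le> ennreal K * (\<integral>\<^sup>+ w\<in>G. h w \<partial>lebesgue)"
    if [measurable]: "G \<in> sets lebesgue" "h \<in> borel_measurable lebesgue"
      and d: "\<forall>x\<in>G. \<forall>y\<in>G. dist x y \<le> d" for G :: "'a set" and h
  proof -
    let ?k = "\<lambda>x w. ennreal (norm (x - w) powr (\<kappa> - real DIM('a)))"
    have [measurable]: "(\<lambda>z. ?k (fst z) (snd z)) \<in> borel_measurable (lebesgue \<Otimes>\<^sub>M lebesgue)"
      by measurable
    have [measurable]: "(\<lambda>w. ?k x w) \<in> borel_measurable lebesgue" "(\<lambda>x. ?k x w) \<in> borel_measurable lebesgue" for x w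
      by (auto intro!: measurable_completion)
    have "(\<integral>\<^sup>+ x\<in>G. riesz_potential G \<kappa> h x \<partial>lebesgue)
        = (\<integral>\<^sup>+ x. (\<integral>\<^sup>+ w. (h w * ?k x w * indicator G w) * indicator G x \<partial>lebesgue) \<partial>lebesgue)"
      unfolding riesz_potential_def by (intro nn_integral_cong nn_integral_multc[symmetric]) measurable
    also have "\<dots> = (\<integral>\<^sup>+ w. (\<integral>\<^sup>+ x. (h w * ?k x w * indicator G w) * indicator G x \<partial>lebesgue) \<partial>lebesgue)"
      by (rule lebesgue_Fubini'[symmetric]) (simp add: case_prod_beta')
    also have "\<dots> \<le> (\<integral>\<^sup>+ w. ennreal K * (h w * indicator G w) \<partial>lebesgue)"
    proof (intro nn_integral_mono)
      fix w
      have "(\<integral>\<^sup>+ x. (h w * ?k x w * indicator G w) * indicator G x \<partial>lebesgue)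
          = (h w * indicator G w) * (\<integral>\<^sup>+ x\<in>G. ?k x w \<partial>lebesgue)"
        by (subst nn_integral_cmult[symmetric]) (auto intro!: nn_integral_cong simp: mult_ac)
      also have "\<dots> \<le> (h w * indicator G w) * ennreal K"
        \<comment> \<open>The kernel bound is available for w in \<open>G\<close>; for other w both
          sides are 0.\<close>
        using K[of G w] d by (cases "w \<in> G") (auto intro!: mult_left_mono)
      finally show "(\<integral>\<^sup>+ x. (h w * ?k x w * indicator G w) * indicator G x \<partial>lebesgue)
          \<le> ennreal K * (h w * indicator G w)"
        by (simp add: mult_ac)
    qed
    also have "\<dots> = ennreal K * (\<integral>\<^sup>+ w\<in>G. h w \<partial>lebesgue)"
      by (rule nn_integral_cmult) measurable
    finally show ?thesis .
  qed
  with \<open>0 \<le> K\<close> show ?thesis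
    by blast
qed

text \<open>Every w in the ball is within 4 \<tau> of u and of v, so |f u - f w|^p is at most (4
  \<tau>)^(n+sp) times the Gagliardo kernel, and likewise for v. The triangle inequality through w
  is then averaged over the ball.\<close>

lemma diff_powr_le_gagliardo:
  fixes f :: "'a::euclidean_space \<Rightarrow> real"
  assumes [measurable]: "f \<in> borel_measurable lebesgue" "G \<in> sets lebesgue"
    and "0 < \<tau>" "0 \<le> s" "0 \<le> p" and G: "ball c \<tau> \<subseteq> G"
    and uv: "dist c u \<le> 3 * \<tau>" "dist c v \<le> 3 * \<tau>"
  shows "ennreal (\<bar>f u - f v\<bar> powr p)
    \<le> ennreal (2 powr p * 4 powr (real DIM('a) + s * p) / unit_ball_vol (real DIM('a)) * \<tau> powr (s * p))
       * (gagliardo G s p f u + gagliardo G s p f v)"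
proof -
  define a where "a = real DIM('a) + s * p"
  define k where "k u w = \<bar>f u - f w\<bar> powr p / norm (u - w) powr a" for u w
  define \<omega> where "\<omega> = unit_ball_vol (real DIM('a))"
  have "0 < \<omega>" "0 \<le> a"
    using assms by (simp_all add: \<omega>_def a_def)
  have k0: "0 \<le> k u w" for u w
    by (simp add: k_def)
  have [measurable]: "(\<lambda>w. ennreal (k u w)) \<in> borel_measurable lebesgue" for u
  proof -
    have [measurable]: "(\<lambda>w. norm (u - w) powr a) \<in> borel_measurable lebesgue"
      by (auto intro!: measurable_completion)
    show ?thesis
      unfolding k_def by measurable
  qed
  have near: "\<bar>f u - f w\<bar> powr p \<le> (4 * \<tau>) powr a * k u w" if "w \<in> ball c \<tau>" "dist c u \<le> 3 * \<tau>" for u w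
  proof (cases "u = w")
    case False
    have "norm (u - w) \<le> 4 * \<tau>"
      using that dist_triangle[of u w c] by (auto simp: dist_norm norm_minus_commute)
    then have "norm (u - w) powr a \<le> (4 * \<tau>) powr a"
      using \<open>0 \<le> a\<close> by (intro powr_mono2) auto
    then have "\<bar>f u - f w\<bar> powr p * norm (u - w) powr a \<le> \<bar>f u - f w\<bar> powr p * (4 * \<tau>) powr a"
      by (intro mult_left_mono) auto
    then show ?thesis
      using False by (simp add: k_def field_simps)
  qed (simp add: k_def)
  have *: "ennreal (\<bar>f u - f v\<bar> powr p) \<le> ennreal (2 powr p * (4 * \<tau>) powr a) * (ennreal (k u w) + ennreal (k v w))"
    if w: "w \<in> ball c \<tau>" for w
  proof -
    have "\<bar>f u - f v\<bar> powr p \<le> (\<bar>f u - f w\<bar> + \<bar>f v - f w\<bar>) powr p"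
      using \<open>0 \<le> p\<close> by (intro powr_mono2) auto
    also have "\<dots> \<le> 2 powr p * (\<bar>f u - f w\<bar> powr p + \<bar>f v - f w\<bar> powr p)"
      using \<open>0 \<le> p\<close> by (intro powr_add_le) auto
    also have "\<dots> \<le> 2 powr p * ((4 * \<tau>) powr a * k u w + (4 * \<tau>) powr a * k v w)"
      using near[OF w] uv by (intro mult_left_mono add_mono) auto
    also have "\<dots> = (2 powr p * (4 * \<tau>) powr a) * (k u w + k v w)"
      by (simp add: algebra_simps)
    finally have "ennreal (\<bar>f u - f v\<bar> powr p) \<le> ennreal (2 powr p * (4 * \<tau>) powr a * (k u w + k v w))"
      by (rule ennreal_leI)
    then show ?thesis
      by (simp add: k0 ennreal_mult)
  qed
  have "ennreal (\<bar>f u - f v\<bar> powr p) * ennreal (\<omega> * \<tau> ^ DIM('a))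
      = (\<integral>\<^sup>+ w\<in>ball c \<tau>. ennreal (\<bar>f u - f v\<bar> powr p) \<partial>lebesgue)"
    using \<open>0 < \<tau>\<close> by (simp add: nn_integral_cmult_indicator emeasure_ball \<omega>_def)
  also have "\<dots> \<le> (\<integral>\<^sup>+ w\<in>G. ennreal (2 powr p * (4 * \<tau>) powr a) * (ennreal (k u w) + ennreal (k v w)) \<partial>lebesgue)"
    using * G by (intro nn_integral_mono) (auto simp: indicator_def)
  also have "\<dots> = ennreal (2 powr p * (4 * \<tau>) powr a) *
      ((\<integral>\<^sup>+ w\<in>G. ennreal (k u w) \<partial>lebesgue) + (\<integral>\<^sup>+ w\<in>G. ennreal (k v w) \<partial>lebesgue))"
    by (simp add: distrib_right mult.assoc nn_integral_cmult nn_integral_add)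
  also have "\<dots> = ennreal (2 powr p * (4 * \<tau>) powr a) * (gagliardo G s p f u + gagliardo G s p f v)" (is "_ = _ * ?g")
    by (simp add: gagliardo_def k_def a_def)
  finally have "ennreal (\<bar>f u - f v\<bar> powr p) * ennreal (\<omega> * \<tau> ^ DIM('a)) * ennreal (1 / (\<omega> * \<tau> ^ DIM('a)))
      \<le> ennreal (2 powr p * (4 * \<tau>) powr a) * ?g * ennreal (1 / (\<omega> * \<tau> ^ DIM('a)))"
    by (rule mult_right_mono) simp
  also have "ennreal (\<bar>f u - f v\<bar> powr p) * ennreal (\<omega> * \<tau> ^ DIM('a)) * ennreal (1 / (\<omega> * \<tau> ^ DIM('a)))
      = ennreal (\<bar>f u - f v\<bar> powr p)"
    using \<open>0 < \<omega>\<close> \<open>0 < \<tau>\<close> by (simp flip: ennreal_mult)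
  also have "ennreal (2 powr p * (4 * \<tau>) powr a) * ?g * ennreal (1 / (\<omega> * \<tau> ^ DIM('a)))
      = ennreal (2 powr p * (4 * \<tau>) powr a * (1 / (\<omega> * \<tau> ^ DIM('a)))) * ?g"
    using \<open>0 < \<omega>\<close> \<open>0 < \<tau>\<close> by (subst ennreal_mult) (simp_all only: mult_ac zero_le_mult_iff powr_ge_zero, simp_all)
  \<comment> \<open>The volume of the ball cancels \<tau>^n from \<tau>^(n+sp), leaving
    \<tau>^(sp).\<close>
  also have "2 powr p * (4 * \<tau>) powr a * (1 / (\<omega> * \<tau> ^ DIM('a))) = 2 powr p * 4 powr a / \<omega> * \<tau> powr (s * p)"
    using \<open>0 < \<omega>\<close> \<open>0 < \<tau>\<close> by (simp add: a_def powr_mult powr_add powr_realpow)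
  finally show ?thesis
    by (simp add: a_def \<omega>_def)
qed

subsection \<open>Means over balls\<close>

text \<open>Integrating over one fixed probability space couples different balls: x + r z is paired
  with y + r' z for the same z. The convention at radius 0 holds without a case distinction.\<close>

definition ball_mean :: "('a::euclidean_space \<Rightarrow> ennreal) \<Rightarrow> 'a \<Rightarrow> real \<Rightarrow> ennreal" where
  "ball_mean h x r = (\<integral>\<^sup>+ z. h (x + r *\<^sub>R z) \<partial>uniform_measure lebesgue (ball 0 1))"

lemma prob_uniform_ball:
  "emeasure (uniform_measure lebesgue (ball (0::'a::euclidean_space) 1)) (space (uniform_measure lebesgue (ball (0::'a) 1))) = 1"
proof -
  have "emeasure lebesgue (ball (0::'a) 1) = ennreal (unit_ball_vol (real DIM('a)))"
    by (simp add: emeasure_ball)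
  then show ?thesis
    by (simp add: emeasure_uniform_measure less_imp_neq[OF unit_ball_vol_pos, symmetric])
qed

lemma nn_integral_uniform_ball_mono:
  fixes h g :: "'a::euclidean_space \<Rightarrow> ennreal"
  assumes "h \<in> borel_measurable lebesgue" "g \<in> borel_measurable lebesgue"
    and "\<And>z. norm z < 1 \<Longrightarrow> h z \<le> g z"
  shows "(\<integral>\<^sup>+ z. h z \<partial>uniform_measure lebesgue (ball 0 1)) \<le> (\<integral>\<^sup>+ z. g z \<partial>uniform_measure lebesgue (ball 0 1))"
  using assms by (auto simp: nn_integral_uniform_measure indicator_def intro!: divide_right_mono_ennreal nn_integral_mono)

lemma ball_mean_0 [simp]: "ball_mean h x 0 = h x"
  unfolding ball_mean_def by (simp add: prob_uniform_ball del: space_uniform_measure)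

lemma ball_mean_pos:
  fixes h :: "'a::euclidean_space \<Rightarrow> ennreal"
  assumes [measurable]: "h \<in> borel_measurable lebesgue" and "0 < r"
  shows "ball_mean h x r = (\<integral>\<^sup>+ y\<in>ball x r. h y \<partial>lebesgue) / emeasure lebesgue (ball x r)"
proof -
  define \<omega> where "\<omega> = unit_ball_vol (real DIM('a))"
  have "0 < \<omega>"
    by (simp add: \<omega>_def)
  have [measurable]: "(\<lambda>z. h (x + r *\<^sub>R z)) \<in> borel_measurable lebesgue"
    by (rule measurable_lebesgue_affine) measurable
  have "indicator (ball x r) (x + r *\<^sub>R z) = (indicator (ball 0 1) z :: ennreal)" for z
    using \<open>0 < r\<close> by (simp add: indicator_def dist_norm)
  then have "(\<integral>\<^sup>+ y\<in>ball x r. h y \<partial>lebesgue)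
      = ennreal (r ^ DIM('a)) * (\<integral>\<^sup>+ z\<in>ball 0 1. h (x + r *\<^sub>R z) \<partial>lebesgue)" (is "_ = _ * ?I")
    using \<open>0 < r\<close> by (subst nn_integral_lebesgue_affine[of _ r x]) (auto intro!: borel_measurable_times_ennreal borel_measurable_indicator)
  moreover have "emeasure lebesgue (ball x r) = ennreal (r ^ DIM('a)) * ennreal \<omega>"
    using \<open>0 < r\<close> \<open>0 < \<omega>\<close> by (simp add: emeasure_ball \<omega>_def mult.commute flip: ennreal_mult)
  moreover have "ennreal (r ^ DIM('a)) * ?I / (ennreal (r ^ DIM('a)) * ennreal \<omega>) = ?I / ennreal \<omega>"
    using \<open>0 < r\<close> by (subst (1 2) mult.commute) (intro divide_mult_eq, auto)
  ultimately show ?thesis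
    by (simp add: ball_mean_def nn_integral_uniform_measure emeasure_ball \<omega>_def)
qed

lemma ball_average_eq_ball_mean:
  assumes [measurable]: "f \<in> borel_measurable lebesgue" and "0 \<le> r"
  shows "ball_average f x r = ball_mean (\<lambda>y. ennreal \<bar>f y\<bar>) x r"
  using \<open>0 \<le> r\<close> by (cases "r = 0") (simp_all add: ball_average_def ball_mean_pos)

lemma nn_integral_le_powr_mean:
  fixes u :: "'a \<Rightarrow> real"
  assumes [measurable]: "u \<in> borel_measurable M" and "emeasure M (space M) = 1"
    and "\<And>z. 0 \<le> u z" and "1 \<le> p"
  shows "(\<integral>\<^sup>+ z. ennreal (u z) \<partial>M) \<le> 2 * epowr (\<integral>\<^sup>+ z. ennreal (u z powr p) \<partial>M) (1 / p)"
proof (cases "\<integral>\<^sup>+ z. ennreal (u z powr p) \<partial>M" rule: ennreal_cases)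
  case (real q)
  have le: "(\<integral>\<^sup>+ z. ennreal (u z) \<partial>M) \<le> ennreal (K + K powr (1 - p) * q)" if "0 < K" for K
  proof -
    \<comment> \<open>A substitute for Jensen's inequality: choosing \<open>K\<close> as the \<open>p\<close>-mean costs only a factor 2.\<close>
    have "u z \<le> K + K powr (1 - p) * u z powr p" for z
    proof (cases "u z \<le> K")
      case False
      then have "1 \<le> (u z / K) powr (p - 1)"
        using \<open>0 < K\<close> \<open>1 \<le> p\<close> by (intro ge_one_powr_ge_zero) auto
      then have "u z * 1 \<le> u z * (u z / K) powr (p - 1)"
        using assms(3) by (intro mult_left_mono) auto
      also have "\<dots> = K powr (1 - p) * u z powr p"
        using False \<open>0 < K\<close> by (simp add: powr_divide powr_diff field_simps)
      finally show ?thesis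
        using \<open>0 < K\<close> by simp
    qed (use \<open>0 < K\<close> in \<open>auto intro: order_trans\<close>)
    then have "(\<integral>\<^sup>+ z. ennreal (u z) \<partial>M) \<le> (\<integral>\<^sup>+ z. ennreal (K + K powr (1 - p) * u z powr p) \<partial>M)"
      by (intro nn_integral_mono ennreal_leI)
    also have "\<dots> = (\<integral>\<^sup>+ z. ennreal K + ennreal (K powr (1 - p)) * ennreal (u z powr p) \<partial>M)"
      using \<open>0 < K\<close> by (simp add: ennreal_mult)
    also have "\<dots> = ennreal K + ennreal (K powr (1 - p)) * (\<integral>\<^sup>+ z. ennreal (u z powr p) \<partial>M)"
      using assms(2) by (simp add: nn_integral_add nn_integral_cmult)
    also have "\<dots> = ennreal (K + K powr (1 - p) * q)"
      using real \<open>0 < K\<close> by (simp add: ennreal_mult)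
    finally show ?thesis .
  qed
  show ?thesis
  proof (cases "q = 0")
    \<comment> \<open>Here the second term disappears for every \<open>K\<close>, and
      \<open>K\<close> can be arbitrarily small.\<close>
    case True
    have "(\<integral>\<^sup>+ z. ennreal (u z) \<partial>M) \<le> 0"
    proof (rule ennreal_le_epsilon)
      fix e :: real assume "0 < e"
      then show "(\<integral>\<^sup>+ z. ennreal (u z) \<partial>M) \<le> 0 + ennreal e"
        using le[of e] True by simp
    qed
    then show ?thesis
      by simp
  next
    case False
    then have "0 < q"
      using real by simp
    \<comment> \<open>For K = q^(1/p) the two summands \<open>K\<close> and
      \<open>K powr (1 - p) * q\<close> coincide.\<close>
    have "(q powr (1 / p)) powr (1 - p) * q = q powr (1 / p * (1 - p) + 1)"
      using \<open>0 < q\<close> by (simp only: powr_powr powr_add powr_one)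
    also have "(1 / p) * (1 - p) + 1 = 1 / p"
      using \<open>1 \<le> p\<close> by (simp add: field_simps)
    finally show ?thesis
      using le[of "q powr (1 / p)"] \<open>0 < q\<close> real by (simp add: epowr_ennreal ennreal_plus ennreal_mult' flip: mult_2)
  qed
qed (simp add: ennreal_mult_top)

text \<open>The triangle inequality at coupled points bounds the excess by the mean of |f(x + r z) -
  f(y + r' z)|, which is then replaced by a p-mean at the cost of the factor 2.\<close>

lemma ball_average_le:
  fixes f :: "'a::euclidean_space \<Rightarrow> real"
  assumes [measurable]: "f \<in> borel_measurable lebesgue" "H \<in> borel_measurable lebesgue"
    and "1 \<le> p" "0 \<le> r" "0 \<le> r'"
    and H: "\<And>z. norm z < 1 \<Longrightarrow> ennreal (\<bar>f (x + r *\<^sub>R z) - f (y + r' *\<^sub>R z)\<bar> powr p) \<le> H z"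
  shows "ball_average f x r
    \<le> ball_average f y r' + 2 * epowr (\<integral>\<^sup>+ z. H z \<partial>uniform_measure lebesgue (ball 0 1)) (1 / p)"
proof -
  let ?U = "uniform_measure lebesgue (ball (0::'a) 1)"
  let ?u = "\<lambda>z. f (x + r *\<^sub>R z)" and ?v = "\<lambda>z. f (y + r' *\<^sub>R z)"
  have [measurable]: "?u \<in> borel_measurable lebesgue" "?v \<in> borel_measurable lebesgue"
    by (rule measurable_lebesgue_affine, measurable)+
  have "ball_average f x r = (\<integral>\<^sup>+ z. ennreal \<bar>?u z\<bar> \<partial>?U)"
    using assms by (simp add: ball_average_eq_ball_mean ball_mean_def)
  also have "\<dots> \<le> (\<integral>\<^sup>+ z. ennreal \<bar>?v z\<bar> + ennreal \<bar>?u z - ?v z\<bar> \<partial>?U)"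
    by (intro nn_integral_mono) (auto simp flip: ennreal_plus intro!: ennreal_leI)
  also have "\<dots> = (\<integral>\<^sup>+ z. ennreal \<bar>?v z\<bar> \<partial>?U) + (\<integral>\<^sup>+ z. ennreal \<bar>?u z - ?v z\<bar> \<partial>?U)"
    by (intro nn_integral_add) simp_all
  also have "(\<integral>\<^sup>+ z. ennreal \<bar>?v z\<bar> \<partial>?U) = ball_average f y r'"
    using assms by (simp add: ball_average_eq_ball_mean ball_mean_def)
  also have "(\<integral>\<^sup>+ z. ennreal \<bar>?u z - ?v z\<bar> \<partial>?U)
      \<le> 2 * epowr (\<integral>\<^sup>+ z. ennreal (\<bar>?u z - ?v z\<bar> powr p) \<partial>?U) (1 / p)"
    using \<open>1 \<le> p\<close> by (intro nn_integral_le_powr_mean prob_uniform_ball) simp_all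
  also have "\<dots> \<le> 2 * epowr (\<integral>\<^sup>+ z. H z \<partial>?U) (1 / p)"
    using \<open>1 \<le> p\<close> H by (intro mult_left_mono epowr_mono nn_integral_uniform_ball_mono) auto
  finally show ?thesis
    by (simp add: add_left_mono)
qed

text \<open>Since \<kappa> \<le> n, the Riesz kernel is at least r^(\<kappa>-n) on the punctured
  ball; dividing by the volume leaves r^(-\<kappa>).\<close>

lemma ball_mean_le_riesz_potential:
  fixes h :: "'a::euclidean_space \<Rightarrow> ennreal"
  assumes [measurable]: "h \<in> borel_measurable lebesgue" and "G \<in> sets lebesgue"
    and "0 < r" "ball x r \<subseteq> G" "\<kappa> \<le> real DIM('a)"
  shows "ball_mean h x r \<le> ennreal (r powr (- \<kappa>) / unit_ball_vol (real DIM('a))) * riesz_potential G \<kappa> h x"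
proof -
  define \<omega> where "\<omega> = unit_ball_vol (real DIM('a))"
  define c where "c = r powr (real DIM('a) - \<kappa>)"
  have "0 < \<omega>" "0 < c"
    using \<open>0 < r\<close> by (simp_all add: \<omega>_def c_def)
  let ?k = "\<lambda>w. norm (x - w) powr (\<kappa> - real DIM('a))"
  have [measurable]: "?k \<in> borel_measurable lebesgue"
    by (auto intro!: measurable_completion)
  \<comment> \<open>The centre has to be removed: the kernel is 0 there, so the pointwise bound can
    fail.\<close>
  have "AE w in lebesgue. w \<noteq> x"
    by (rule AE_completion) (rule AE_lborel_singleton)
  then have "(\<integral>\<^sup>+ y\<in>ball x r. h y \<partial>lebesgue) \<le> (\<integral>\<^sup>+ w. ennreal c * (h w * ennreal (?k w) * indicator G w) \<partial>lebesgue)"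
  proof (intro nn_integral_mono_AE, eventually_elim)
    fix w :: 'a assume "w \<noteq> x"
    show "h w * indicator (ball x r) w \<le> ennreal c * (h w * ennreal (?k w) * indicator G w)"
    proof (cases "w \<in> ball x r")
      case True
      have "r powr (\<kappa> - real DIM('a)) \<le> ?k w"
        using True \<open>w \<noteq> x\<close> assms by (intro powr_mono2') (auto simp: dist_norm)
      then have "c * r powr (\<kappa> - real DIM('a)) \<le> c * ?k w"
        using \<open>0 < c\<close> by (intro mult_left_mono) auto
      moreover have "c * r powr (\<kappa> - real DIM('a)) = 1"
        using \<open>0 < r\<close> by (simp add: c_def flip: powr_add)
      ultimately have "ennreal 1 \<le> ennreal (c * ?k w)"
        by (intro ennreal_leI) simp
      then have "h w * 1 \<le> h w * ennreal (c * ?k w)"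
        by (intro mult_left_mono) auto
      then show ?thesis
        using True assms \<open>0 < c\<close> by (auto simp: ennreal_mult mult_ac)
    qed simp
  qed
  also have "\<dots> = ennreal c * riesz_potential G \<kappa> h x"
    using \<open>G \<in> sets lebesgue\<close> by (simp add: nn_integral_cmult riesz_potential_def)
  finally have "ball_mean h x r \<le> ennreal c * riesz_potential G \<kappa> h x / ennreal (\<omega> * r ^ DIM('a))"
    using \<open>0 < r\<close> by (simp add: ball_mean_pos emeasure_ball \<omega>_def divide_right_mono_ennreal)
  also have "\<dots> = ennreal (c / (\<omega> * r ^ DIM('a))) * riesz_potential G \<kappa> h x"
    using \<open>0 < r\<close> \<open>0 < \<omega>\<close> \<open>0 < c\<close>
    by (simp add: divide_ennreal[symmetric] divide_ennreal_def mult_ac)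
  also have "c / (\<omega> * r ^ DIM('a)) = r powr (- \<kappa>) / \<omega>"
    using \<open>0 < r\<close> \<open>0 < \<omega>\<close> by (simp add: c_def powr_diff powr_minus powr_realpow field_simps)
  finally show ?thesis
    by (simp add: \<omega>_def)
qed

subsection \<open>Comparison of averages over different balls\<close>

text \<open>For r > 0 the loss r^(-\<kappa>) is at most \<tau>^(-\<kappa>), which the factor
  \<tau>^(sp) absorbs, leaving \<theta>^(sp-\<kappa>). For r = 0 nothing is lost and \<tau>^(sp)
  \<le> \<theta>^(sp-\<kappa>) \<theta>^\<kappa>. The sum in the constant covers both cases.\<close>

lemma ball_mean_gagliardo_le_energy:
  fixes f :: "'a::euclidean_space \<Rightarrow> real"
  assumes [measurable]: "f \<in> borel_measurable lebesgue" "G \<in> sets lebesgue"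
    and \<kappa>: "0 \<le> \<kappa>" "\<kappa> \<le> real DIM('a)" "\<kappa> \<le> s * p" and "0 < \<tau>" "\<tau> \<le> \<theta>"
    and r: "r = 0 \<or> \<tau> \<le> r \<and> ball x r \<subseteq> G"
  shows "ennreal (\<tau> powr (s * p)) * ball_mean (gagliardo G s p f) x r
    \<le> ennreal (\<theta> powr (s * p - \<kappa>) * (\<theta> powr \<kappa> + 1 / unit_ball_vol (real DIM('a)))) * energy G s p \<kappa> f x"
proof -
  define \<omega> where "\<omega> = unit_ball_vol (real DIM('a))"
  have "0 < \<omega>"
    by (simp add: \<omega>_def)
  have \<tau>: "\<tau> powr (s * p - \<kappa>) \<le> \<theta> powr (s * p - \<kappa>)"
    using assms by (intro powr_mono2) auto
  show ?thesis
  proof (cases "r = 0")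
    case True
    have "\<tau> powr (s * p) \<le> \<theta> powr (s * p)"
      using assms by (intro powr_mono2) auto
    also have "\<dots> = \<theta> powr (s * p - \<kappa>) * \<theta> powr \<kappa>"
      by (simp flip: powr_add)
    also have "\<dots> \<le> \<theta> powr (s * p - \<kappa>) * (\<theta> powr \<kappa> + 1 / \<omega>)"
      using \<open>0 < \<omega>\<close> by (intro mult_left_mono) auto
    finally show ?thesis
      using True by (auto simp: energy_def \<omega>_def intro!: mult_mono ennreal_leI)
  next
    case False
    with r \<open>0 < \<tau>\<close> have r: "0 < r" "\<tau> \<le> r" "ball x r \<subseteq> G"
      by auto
    have "r powr (- \<kappa>) \<le> \<tau> powr (- \<kappa>)"
      using r \<open>0 < \<tau>\<close> \<kappa> by (intro powr_mono2') auto
    then have "\<tau> powr (s * p) * r powr (- \<kappa>) \<le> \<tau> powr (s * p) * \<tau> powr (- \<kappa>)"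
      by (intro mult_left_mono) auto
    also have "\<dots> = \<tau> powr (s * p - \<kappa>)"
      by (simp flip: powr_add)
    finally have "\<tau> powr (s * p) * (r powr (- \<kappa>) / \<omega>) \<le> \<theta> powr (s * p - \<kappa>) * (1 / \<omega>)"
      using \<tau> \<open>0 < \<omega>\<close> by (simp add: divide_right_mono)
    also have "\<dots> \<le> \<theta> powr (s * p - \<kappa>) * (\<theta> powr \<kappa> + 1 / \<omega>)"
      by (intro mult_left_mono) auto
    finally have *: "\<tau> powr (s * p) * (r powr (- \<kappa>) / \<omega>) \<le> \<theta> powr (s * p - \<kappa>) * (\<theta> powr \<kappa> + 1 / \<omega>)" .
    have "ennreal (\<tau> powr (s * p)) * ball_mean (gagliardo G s p f) x r
        \<le> ennreal (\<tau> powr (s * p)) * (ennreal (r powr (- \<kappa>) / \<omega>) * riesz_potential G \<kappa> (gagliardo G s p f) x)"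
      unfolding \<omega>_def using r \<kappa> by (intro mult_left_mono ball_mean_le_riesz_potential) auto
    also have "\<dots> = ennreal (\<tau> powr (s * p) * (r powr (- \<kappa>) / \<omega>)) * riesz_potential G \<kappa> (gagliardo G s p f) x"
      using \<open>0 < \<omega>\<close> by (simp add: ennreal_mult mult.assoc del: times_divide_eq_right)
    also have "\<dots> \<le> ennreal (\<theta> powr (s * p - \<kappa>) * (\<theta> powr \<kappa> + 1 / \<omega>)) * energy G s p \<kappa> f x"
      using * by (auto simp: energy_def intro!: mult_mono ennreal_leI)
    finally show ?thesis
      by (simp add: \<omega>_def)
  qed
qed

text \<open>The constant of \<open>diff_powr_le_gagliardo\<close>, without the power of \<tau>; the
  type argument carries the dimension.\<close>

definition step_const :: "'a::euclidean_space itself \<Rightarrow> real \<Rightarrow> real \<Rightarrow> real" where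
  "step_const _ s p = 2 powr p * 4 powr (real DIM('a) + s * p) / unit_ball_vol (real DIM('a))"

lemma step_const_nonneg: "0 \<le> step_const TYPE('a::euclidean_space) s p"
  by (simp add: step_const_def)

text \<open>The coefficient of the energies in one comparison of averages at scale \<theta>:
  \<open>step_const\<close> times the factor from
  \<open>ball_mean_gagliardo_le_energy\<close>.\<close>

definition step_error :: "'a::euclidean_space itself \<Rightarrow> real \<Rightarrow> real \<Rightarrow> real \<Rightarrow> real \<Rightarrow> real" where
  "step_error T s p \<kappa> \<theta> = step_const T s p * (\<theta> powr (s * p - \<kappa>) * (\<theta> powr \<kappa> + 1 / unit_ball_vol (real DIM('a))))"

lemma step_error_nonneg: "0 \<le> step_error TYPE('a::euclidean_space) s p \<kappa> \<theta>"
  by (simp add: step_error_def step_const_nonneg)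

text \<open>The points \<open>x + r z\<close> and \<open>y + r' z\<close> are joined through the ball of radius \<open>\<tau>\<close> around \<open>c + \<rho> z\<close>.\<close>

lemma ball_average_step:
  fixes f :: "'a::euclidean_space \<Rightarrow> real"
  assumes [measurable]: "f \<in> borel_measurable lebesgue" "G \<in> sets lebesgue"
    and "0 \<le> s" "1 \<le> p" and \<kappa>: "0 \<le> \<kappa>" "\<kappa> \<le> real DIM('a)" "\<kappa> \<le> s * p" and \<tau>: "0 < \<tau>" "\<tau> \<le> \<theta>"
    and r: "r = 0 \<or> \<tau> \<le> r \<and> ball x r \<subseteq> G" and r': "r' = 0 \<or> \<tau> \<le> r' \<and> ball y r' \<subseteq> G"
    and c: "0 \<le> \<rho>" "ball c (\<rho> + \<tau>) \<subseteq> G" "dist c x + \<bar>\<rho> - r\<bar> \<le> 3 * \<tau>" "dist c y + \<bar>\<rho> - r'\<bar> \<le> 3 * \<tau>"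
  shows "ball_average f x r \<le> ball_average f y r' + 2 * epowr
    (ennreal (step_error TYPE('a) s p \<kappa> \<theta>) * (energy G s p \<kappa> f x + energy G s p \<kappa> f y)) (1 / p)"
proof -
  define g where "g = gagliardo G s p f"
  have [measurable]: "g \<in> borel_measurable lebesgue"
    unfolding g_def by measurable
  have [measurable]: "(\<lambda>z. g (x + r *\<^sub>R z)) \<in> borel_measurable lebesgue" "(\<lambda>z. g (y + r' *\<^sub>R z)) \<in> borel_measurable lebesgue"
    by (rule measurable_lebesgue_affine, measurable)+
  let ?U = "uniform_measure lebesgue (ball (0::'a) 1)"
  let ?C = "step_const TYPE('a) s p"
  define H where "H z = ennreal (?C * \<tau> powr (s * p)) * (g (x + r *\<^sub>R z) + g (y + r' *\<^sub>R z))" for z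
  \<comment> \<open>This bound is uniform in z, so the distance conditions on \<open>c\<close> and
    \<rho> can be stated for centres and radii alone.\<close>
  have near: "dist (c + \<rho> *\<^sub>R z) (a + t *\<^sub>R z) \<le> dist c a + \<bar>\<rho> - t\<bar>" if "norm z < 1" for z a :: 'a and t
  proof -
    have "norm ((c + \<rho> *\<^sub>R z) - (a + t *\<^sub>R z)) = norm ((c - a) + (\<rho> - t) *\<^sub>R z)"
      by (simp add: algebra_simps)
    also have "\<dots> \<le> norm (c - a) + \<bar>\<rho> - t\<bar> * norm z"
      by (metis norm_scaleR norm_triangle_ineq)
    also have "\<dots> \<le> norm (c - a) + \<bar>\<rho> - t\<bar> * 1"
      using that by (intro add_left_mono mult_left_mono) auto
    finally show ?thesis
      by (simp add: dist_norm)
  qed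
  have "ball_average f x r \<le> ball_average f y r' + 2 * epowr (\<integral>\<^sup>+ z. H z \<partial>?U) (1 / p)"
  proof (rule ball_average_le)
    show "H \<in> borel_measurable lebesgue"
      unfolding H_def by measurable
    show "ennreal (\<bar>f (x + r *\<^sub>R z) - f (y + r' *\<^sub>R z)\<bar> powr p) \<le> H z" if z: "norm z < 1" for z
      unfolding H_def g_def step_const_def
    proof (rule diff_powr_le_gagliardo)
      show "ball (c + \<rho> *\<^sub>R z) \<tau> \<subseteq> G"
      proof
        fix w assume w: "w \<in> ball (c + \<rho> *\<^sub>R z) \<tau>"
        have "\<rho> * norm z \<le> \<rho> * 1"
          using z \<open>0 \<le> \<rho>\<close> by (intro mult_left_mono) auto
        then have "dist c w < \<rho> + \<tau>"
          using w dist_triangle[of c w "c + \<rho> *\<^sub>R z"] \<open>0 \<le> \<rho>\<close> by (simp add: dist_norm)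
        then show "w \<in> G"
          using c(2) by auto
      qed
      show "dist (c + \<rho> *\<^sub>R z) (x + r *\<^sub>R z) \<le> 3 * \<tau>" "dist (c + \<rho> *\<^sub>R z) (y + r' *\<^sub>R z) \<le> 3 * \<tau>"
        using near[OF z, of x r] near[OF z, of y r'] c by linarith+
    qed (use assms in auto)
  qed (use assms in auto)
  also have "(\<integral>\<^sup>+ z. H z \<partial>?U) = ennreal ?C * (ennreal (\<tau> powr (s * p)) * ball_mean g x r + ennreal (\<tau> powr (s * p)) * ball_mean g y r')"
    unfolding H_def ball_mean_def
    by (simp add: nn_integral_cmult nn_integral_add ennreal_mult step_const_nonneg algebra_simps)
  also have "epowr \<dots> (1 / p) \<le> epowr
      (ennreal ?C * (ennreal (\<theta> powr (s * p - \<kappa>) * (\<theta> powr \<kappa> + 1 / unit_ball_vol (real DIM('a)))) * energy G s p \<kappa> f x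
        + ennreal (\<theta> powr (s * p - \<kappa>) * (\<theta> powr \<kappa> + 1 / unit_ball_vol (real DIM('a)))) * energy G s p \<kappa> f y)) (1 / p)"
    unfolding g_def using assms
    by (intro epowr_mono mult_left_mono add_mono ball_mean_gagliardo_le_energy) auto
  also have "ennreal ?C * (ennreal (\<theta> powr (s * p - \<kappa>) * (\<theta> powr \<kappa> + 1 / unit_ball_vol (real DIM('a)))) * energy G s p \<kappa> f x
        + ennreal (\<theta> powr (s * p - \<kappa>) * (\<theta> powr \<kappa> + 1 / unit_ball_vol (real DIM('a)))) * energy G s p \<kappa> f y)
      = ennreal (step_error TYPE('a) s p \<kappa> \<theta>) * (energy G s p \<kappa> f x + energy G s p \<kappa> f y)"
    unfolding step_error_def
    by (subst ennreal_mult) (simp_all only: step_const_nonneg distrib_left mult.assoc, simp_all)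
  finally show ?thesis
    by (simp add: mult_left_mono add_left_mono)
qed

lemma ball_average_le_center:
  fixes f :: "'a::euclidean_space \<Rightarrow> real"
  assumes "f \<in> borel_measurable lebesgue" "G \<in> sets lebesgue"
    and "0 \<le> s" "1 \<le> p" "0 \<le> \<kappa>" "\<kappa> \<le> real DIM('a)" "\<kappa> \<le> s * p"
    and "0 \<le> r" "r \<le> 2 * \<theta>" "ball x r \<subseteq> G"
  shows "ball_average f x r \<le> ennreal \<bar>f x\<bar> + 2 * epowr
    (ennreal (step_error TYPE('a) s p \<kappa> \<theta>) * (energy G s p \<kappa> f x + energy G s p \<kappa> f x)) (1 / p)"
proof (cases "r = 0")
  case True
  then show ?thesis
    by (simp add: ball_average_def)
next
  case False
  then have "ball_average f x r \<le> ball_average f x 0 + 2 * epowr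
    (ennreal (step_error TYPE('a) s p \<kappa> \<theta>) * (energy G s p \<kappa> f x + energy G s p \<kappa> f x)) (1 / p)"
    \<comment> \<open>With \<rho> = \<tau> = r/2 the ball of radius \<rho> + \<tau> is B(x,r)
      itself, and \<rho> is at distance \<tau> from both radii r and 0. The condition \<tau> \<le>
      \<theta> is r \<le> 2 \<theta>.\<close>
    using assms by (intro ball_average_step[where c = x and \<rho> = "r / 2" and \<tau> = "r / 2"]) auto
  then show ?thesis
    by (simp add: ball_average_def)
qed

text \<open>A small radius costs one comparison with the centre and the difference |f x - f y|, a
  total factor 3; a large radius costs two comparisons, a total factor 4. One symmetric error term
  dominates all of these costs, so x and y can later be exchanged.\<close>

lemma ball_average_le_SUP:
  fixes f :: "'a::euclidean_space \<Rightarrow> real"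
  assumes meas: "f \<in> borel_measurable lebesgue" "G \<in> sets lebesgue"
    and exps: "0 \<le> s" "1 \<le> p" "0 \<le> \<kappa>" "\<kappa> \<le> real DIM('a)" "\<kappa> \<le> s * p"
    and R: "0 \<le> R y" "ball x (R x) \<subseteq> G" "ball y (R y) \<subseteq> G" "\<bar>R x - R y\<bar> \<le> \<theta>"
    and xy: "x \<noteq> y" "dist x y \<le> \<theta>"
    and r: "0 \<le> r" "r \<le> R x"
  shows "ball_average f x r \<le> (SUP r\<in>{0..R y}. ball_average f y r) + 4 * epowr
    (ennreal (\<bar>f x - f y\<bar> powr p)
      + ennreal (2 * step_error TYPE('a) s p \<kappa> \<theta>) * (energy G s p \<kappa> f x + energy G s p \<kappa> f y)) (1 / p)"
    (is "_ \<le> ?M + 4 * epowr ?T _")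
proof -
  let ?e = "energy G s p \<kappa> f"
  let ?c = "step_error TYPE('a) s p \<kappa> \<theta>"
  have xr: "ball x r \<subseteq> G"
    using R r subset_ball[of r "R x" x] by blast
  \<comment> \<open>A comparison with both centres at x counts its energy twice; this is the reason
    for the factor 2 in the error term.\<close>
  have "ennreal ?c * (?e x + ?e x) \<le> ?T" "ennreal ?c * (?e x + ?e y) \<le> ?T"
  proof -
    have "ennreal (2 * ?c) = ennreal ?c + ennreal ?c"
      using ennreal_plus[OF step_error_nonneg step_error_nonneg] by (simp only: mult_2)
    then have "ennreal ?c * (?e x + ?e x) = ennreal (2 * ?c) * ?e x"
      by (simp only: distrib_left distrib_right)
    also have "\<dots> \<le> ennreal (2 * ?c) * (?e x + ?e y)"
      by (intro mult_left_mono) auto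
    finally have "ennreal ?c * (?e x + ?e x) \<le> ennreal (2 * ?c) * (?e x + ?e y)" .
    then show "ennreal ?c * (?e x + ?e x) \<le> ?T"
      by (rule add_increasing[rotated]) simp
    have "ennreal ?c * (?e x + ?e y) \<le> ennreal (2 * ?c) * (?e x + ?e y)"
      by (intro mult_right_mono ennreal_leI) (use step_error_nonneg[of s p \<kappa> \<theta>, where ?'a = 'a] in auto)
    then show "ennreal ?c * (?e x + ?e y) \<le> ?T"
      by (rule add_increasing[rotated]) simp
  qed
  then have T: "epowr (ennreal ?c * (?e x + ?e x)) (1 / p) \<le> epowr ?T (1 / p)"
    "epowr (ennreal ?c * (?e x + ?e y)) (1 / p) \<le> epowr ?T (1 / p)"
    using exps by (auto intro!: epowr_mono)
  show ?thesis
  proof (cases "r \<le> 2 * \<theta>")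
    case True
    have "ball_average f x r \<le> ennreal \<bar>f x\<bar> + 2 * epowr (ennreal ?c * (?e x + ?e x)) (1 / p)"
      using meas exps r True xr by (intro ball_average_le_center) auto
    also have "ennreal \<bar>f x\<bar> \<le> ennreal \<bar>f y\<bar> + ennreal \<bar>f x - f y\<bar>"
      by (auto simp flip: ennreal_plus intro!: ennreal_leI)
    also have "ennreal \<bar>f x - f y\<bar> = epowr (ennreal (\<bar>f x - f y\<bar> powr p)) (1 / p)"
      using exps by (simp add: epowr_ennreal powr_powr)
    also have "\<dots> \<le> epowr ?T (1 / p)"
      using exps by (intro epowr_mono) (auto simp: add_increasing2)
    also have "ennreal \<bar>f y\<bar> = ball_average f y 0"
      by (simp add: ball_average_def)
    also have "\<dots> \<le> ?M"
      using R by (intro SUP_upper) auto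
    also note T(1)
    finally have "ball_average f x r \<le> ?M + epowr ?T (1 / p) + 2 * epowr ?T (1 / p)"
      by (simp add: add_mono mult_left_mono)
    also have "\<dots> = ?M + 3 * epowr ?T (1 / p)"
      using distrib_right[of 1 2 "epowr ?T (1 / p)"] by (simp add: add.assoc)
    also have "\<dots> \<le> ?M + 4 * epowr ?T (1 / p)"
      by (intro add_left_mono mult_right_mono) auto
    finally show ?thesis .
  next
    case False
    \<comment> \<open>Since r \<le> R x \<le> R y + \<theta>, shrinking to \<open>r'\<close> loses
      at most \<theta>; as r > 2 \<theta>, at least \<theta> remains.\<close>
    define r' where "r' = min r (R y)"
    have "0 < \<theta>"
      using dist_pos_lt[OF xy(1)] xy(2) by linarith
    then have r': "r' \<le> r" "r - r' \<le> \<theta>" "\<theta> \<le> r'" "0 < \<theta>" "r' \<in> {0..R y}"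
      using False R r by (auto simp: r'_def)
    have yr': "ball y r' \<subseteq> G" and xr': "ball x r' \<subseteq> G"
      using R xr r' subset_ball[of r' "R y" y] subset_ball[of r' r x] by auto
    have "ball_average f x r \<le> ball_average f x r' + 2 * epowr (ennreal ?c * (?e x + ?e x)) (1 / p)"
    proof (cases "r = r'")
      case neq: False
      show ?thesis
        using meas exps r r' xr xr' neq
        \<comment> \<open>Here \<rho> is the midpoint of the two radii, so \<rho> + \<tau> = r and
          both radii are at distance \<tau> from it. The case r = r' is separate because \<tau> must
          be positive.\<close>
        by (intro ball_average_step[where c = x and \<rho> = "(r + r') / 2" and \<tau> = "(r - r') / 2"])
          (auto simp: abs_if field_simps)
    qed simp
    also have "ball_average f x r' \<le> ball_average f y r' + 2 * epowr (ennreal ?c * (?e x + ?e y)) (1 / p)"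
      using meas exps r' xr' yr' xy
      \<comment> \<open>Now \<rho> + \<tau> = r', so the joining ball stays in B(x,r'). Seen from y,
        the distance 2 \<tau> of the centres plus |\<rho> - r'| = \<tau> gives exactly the permitted
        3 \<tau>.\<close>
      by (intro ball_average_step[where c = x and \<rho> = "r' - dist x y / 2" and \<tau> = "dist x y / 2"])
        (auto simp: field_simps)
    also have "ball_average f y r' \<le> ?M"
      using r' by (intro SUP_upper) auto
    also note T(1)
    also note T(2)
    finally have "ball_average f x r \<le> ?M + 2 * epowr ?T (1 / p) + 2 * epowr ?T (1 / p)"
      by (simp add: add_mono mult_left_mono)
    also have "\<dots> = ?M + 4 * epowr ?T (1 / p)"
      using distrib_right[of 2 2 "epowr ?T (1 / p)"] by (simp add: add.assoc)
    finally show ?thesis .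
  qed
qed

subsection \<open>Pointwise estimates for the local maximal function\<close>

text \<open>A ball is connected: if it met both \<open>G\<close> and its complement, it would
  contain a frontier point closer to x than r.\<close>

lemma ball_infdist_frontier_subset:
  fixes G :: "'a::euclidean_space set"
  assumes "x \<in> G" "r \<le> infdist x (frontier G)"
  shows "ball x r \<subseteq> G"
proof (rule ccontr)
  assume "\<not> ball x r \<subseteq> G"
  then have "0 < r"
    by (metis ball_empty empty_subsetI not_less)
  then have "x \<in> ball x r"
    by simp
  then have "ball x r \<inter> frontier G \<noteq> {}"
    using \<open>x \<in> G\<close> \<open>\<not> ball x r \<subseteq> G\<close> by (intro connected_Int_frontier[OF connected_ball]) blast+
  then obtain z where "z \<in> frontier G" "dist x z < r"
    by auto
  then show False
    using infdist_le[of z "frontier G" x] assms by simp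
qed

text \<open>Finiteness of \<open>a\<close> excludes \<infinity> - \<infinity>, which is \<infinity>
  in \<open>ereal\<close>. When \<open>E\<close> is finite, the last inequality makes
  \<open>b\<close> finite too.\<close>

lemma e2ennreal_abs_diff_le:
  fixes a b E :: ennreal
  assumes "a < top" "a \<le> b + E" "b \<le> a + E"
  shows "e2ennreal \<bar>enn2ereal a - enn2ereal b\<bar> \<le> E"
proof (cases E rule: ennreal_cases)
  case (real e)
  obtain a' where a: "a = ennreal a'" "0 \<le> a'"
    using assms(1) by (cases a rule: ennreal_cases) auto
  then have "b < top"
    using assms(3) real by (auto simp: le_less_trans simp flip: ennreal_plus)
  then obtain b' where b: "b = ennreal b'" "0 \<le> b'"
    by (cases b rule: ennreal_cases) auto
  have "a' \<le> b' + e" "b' \<le> a' + e"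
    using assms a b real by (auto simp flip: ennreal_plus simp: ennreal_le_iff)
  then have "\<bar>a' - b'\<bar> \<le> e"
    by auto
  moreover have "e2ennreal \<bar>enn2ereal a - enn2ereal b\<bar> = ennreal \<bar>a' - b'\<bar>"
    using a b by (simp add: e2ennreal_ereal)
  ultimately show ?thesis
    using real by (simp add: ennreal_leI)
qed simp

text \<open>With \<theta> = R x every admissible radius is at most 2 \<theta>, so the comparison
  with the centre bounds all averages at once.\<close>

lemma local_maximal_finite:
  fixes f :: "'a::euclidean_space \<Rightarrow> real"
  assumes "f \<in> borel_measurable lebesgue" "G \<in> sets lebesgue"
    and "0 \<le> s" "1 \<le> p" "0 \<le> \<kappa>" "\<kappa> \<le> real DIM('a)" "\<kappa> \<le> s * p"
    and "ball x (R x) \<subseteq> G" and e: "energy G s p \<kappa> f x < top"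
  shows "(SUP r\<in>{0..R x}. ball_average f x r) < top"
proof -
  let ?T = "ennreal (step_error TYPE('a) s p \<kappa> (R x)) * (energy G s p \<kappa> f x + energy G s p \<kappa> f x)"
  have "ball_average f x r \<le> ennreal \<bar>f x\<bar> + 2 * epowr ?T (1 / p)" if "r \<in> {0..R x}" for r
    using assms that subset_ball[of r "R x" x] by (intro ball_average_le_center) auto
  then have "(SUP r\<in>{0..R x}. ball_average f x r) \<le> ennreal \<bar>f x\<bar> + 2 * epowr ?T (1 / p)"
    by (rule SUP_least)
  also have "?T < top"
    using e by (simp add: ennreal_mult_less_top)
  then have "epowr ?T (1 / p) < top"
    by (simp add: epowr_def less_top)
  then have "ennreal \<bar>f x\<bar> + 2 * epowr ?T (1 / p) < top"
    by (simp add: ennreal_mult_less_top)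
  finally show ?thesis .
qed

text \<open>\<open>ball_average_le_SUP\<close> is applied in both directions; finite energy at x
  makes the maximal function finite there, so the two bounds control the difference.\<close>

lemma local_maximal_diff_powr_le:
  fixes f :: "'a::euclidean_space \<Rightarrow> real"
  assumes "f \<in> borel_measurable lebesgue" "G \<in> sets lebesgue"
    and "0 \<le> s" "1 \<le> p" "0 \<le> \<kappa>" "\<kappa> \<le> real DIM('a)" "\<kappa> \<le> s * p"
    and "0 \<le> R x" "0 \<le> R y" "ball x (R x) \<subseteq> G" "ball y (R y) \<subseteq> G" "\<bar>R x - R y\<bar> \<le> \<theta>"
    and "x \<noteq> y" "dist x y \<le> \<theta>" and e: "energy G s p \<kappa> f x < top"
  shows "epowr (e2ennreal \<bar>local_maximal R f x - local_maximal R f y\<bar>) p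
    \<le> ennreal (4 powr p) * (ennreal (\<bar>f x - f y\<bar> powr p)
      + ennreal (2 * step_error TYPE('a) s p \<kappa> \<theta>) * (energy G s p \<kappa> f x + energy G s p \<kappa> f y))"
    (is "_ \<le> _ * ?T")
proof -
  let ?M = "\<lambda>x. SUP r\<in>{0..R x}. ball_average f x r"
  have "?M x < top"
    using assms by (intro local_maximal_finite) auto
  moreover have "?M x \<le> ?M y + 4 * epowr ?T (1 / p)"
    by (rule SUP_least, rule ball_average_le_SUP) (use assms in auto)
  moreover have "?M y \<le> ?M x + 4 * epowr ?T (1 / p)"
  proof (rule SUP_least)
    fix r assume "r \<in> {0..R y}"
    then show "ball_average f y r \<le> ?M x + 4 * epowr ?T (1 / p)"
      using ball_average_le_SUP[of f G s p \<kappa> R x y \<theta> r] assms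
      by (simp add: abs_minus_commute dist_commute add.commute)
  qed
  ultimately have "e2ennreal \<bar>local_maximal R f x - local_maximal R f y\<bar> \<le> 4 * epowr ?T (1 / p)"
    unfolding local_maximal_def by (rule e2ennreal_abs_diff_le)
  then have "epowr (e2ennreal \<bar>local_maximal R f x - local_maximal R f y\<bar>) p
      \<le> epowr (ennreal 4 * epowr ?T (1 / p)) p"
    using \<open>1 \<le> p\<close> by (intro epowr_mono) auto
  also have "\<dots> = ennreal (4 powr p) * ?T"
    using \<open>1 \<le> p\<close> by (subst epowr_cmult) (auto simp: epowr_epowr_inverse)
  finally show ?thesis .
qed

text \<open>What remains of \<open>step_error\<close> at scale \<Lambda> \<delta>^\<alpha> once the
  power of \<delta> is extracted; \<theta> is then a bound for that scale.\<close>

definition step_coeff :: "'a::euclidean_space itself \<Rightarrow> real \<Rightarrow> real \<Rightarrow> real \<Rightarrow> real \<Rightarrow> real \<Rightarrow> real" where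
  "step_coeff T s p \<kappa> \<Lambda> \<theta> =
     step_const T s p * (\<Lambda> powr (s * p - \<kappa>) * (\<theta> powr \<kappa> + 1 / unit_ball_vol (real DIM('a))))"

lemma step_coeff_nonneg: "0 \<le> step_coeff TYPE('a::euclidean_space) s p \<kappa> \<Lambda> \<theta>"
  by (simp add: step_coeff_def step_const_nonneg)

text \<open>The power of exponent sp - \<kappa> splits exactly, giving the decay in \<delta>; in the
  power of exponent \<kappa>, \<delta> is simply replaced by d.\<close>

lemma step_error_le:
  assumes "0 \<le> \<Lambda>" "0 \<le> \<delta>" "\<delta> \<le> d" "0 \<le> \<alpha>" "0 \<le> \<kappa>"
  shows "step_error TYPE('a::euclidean_space) s p \<kappa> (\<Lambda> * \<delta> powr \<alpha>)
    \<le> step_coeff TYPE('a) s p \<kappa> \<Lambda> (\<Lambda> * d powr \<alpha>) * \<delta> powr (\<alpha> * (s * p - \<kappa>))"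
proof -
  have "(\<Lambda> * \<delta> powr \<alpha>) powr \<kappa> \<le> (\<Lambda> * d powr \<alpha>) powr \<kappa>"
    using assms by (intro powr_mono2 mult_left_mono) auto
  then have "(\<Lambda> * \<delta> powr \<alpha>) powr (s * p - \<kappa>) * ((\<Lambda> * \<delta> powr \<alpha>) powr \<kappa> + 1 / unit_ball_vol (real DIM('a)))
      \<le> (\<Lambda> powr (s * p - \<kappa>) * \<delta> powr (\<alpha> * (s * p - \<kappa>))) * ((\<Lambda> * d powr \<alpha>) powr \<kappa> + 1 / unit_ball_vol (real DIM('a)))"
    using assms by (intro mult_mono add_mono) (auto simp: powr_mult powr_powr)
  then have "step_const TYPE('a) s p * ((\<Lambda> * \<delta> powr \<alpha>) powr (s * p - \<kappa>) * ((\<Lambda> * \<delta> powr \<alpha>) powr \<kappa> + 1 / unit_ball_vol (real DIM('a))))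
      \<le> step_const TYPE('a) s p * ((\<Lambda> powr (s * p - \<kappa>) * \<delta> powr (\<alpha> * (s * p - \<kappa>))) * ((\<Lambda> * d powr \<alpha>) powr \<kappa> + 1 / unit_ball_vol (real DIM('a))))"
    by (intro mult_left_mono step_const_nonneg)
  then show ?thesis
    by (simp only: step_error_def step_coeff_def mult_ac)
qed

text \<open>Division by \<delta>^(n+\<sigma>p) turns the first error into the Gagliardo quotient of
  order s, at the cost d^((s-\<sigma>)p), and turns \<delta>^(\<alpha>(sp-\<kappa>)) into the Riesz
  kernel of order \<beta>.\<close>

lemma local_maximal_quotient_le:
  fixes f :: "'a::euclidean_space \<Rightarrow> real"
  assumes "f \<in> borel_measurable lebesgue" "G \<in> sets lebesgue"
    and "0 \<le> s" "1 \<le> p" "0 \<le> \<kappa>" "\<kappa> \<le> real DIM('a)" "\<kappa> \<le> s * p" "0 \<le> \<alpha>" "\<sigma> \<le> s"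
    and "0 \<le> R x" "0 \<le> R y" "ball x (R x) \<subseteq> G" "ball y (R y) \<subseteq> G"
    and "0 \<le> \<Lambda>" "\<bar>R x - R y\<bar> \<le> \<Lambda> * norm (x - y) powr \<alpha>" "norm (x - y) \<le> \<Lambda> * norm (x - y) powr \<alpha>"
    and "norm (x - y) \<le> d" and e: "energy G s p \<kappa> f x < top"
  defines "\<beta> \<equiv> \<alpha> * (s * p - \<kappa>) - \<sigma> * p"
  shows "epowr (e2ennreal \<bar>local_maximal R f x - local_maximal R f y\<bar>) p
      / ennreal (norm (x - y) powr (real DIM('a) + \<sigma> * p))
    \<le> ennreal (4 powr p) * (ennreal (d powr ((s - \<sigma>) * p))
        * ennreal (\<bar>f x - f y\<bar> powr p / norm (x - y) powr (real DIM('a) + s * p))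
      + ennreal (2 * step_coeff TYPE('a) s p \<kappa> \<Lambda> (\<Lambda> * d powr \<alpha>))
        * ((energy G s p \<kappa> f x + energy G s p \<kappa> f y) * ennreal (norm (x - y) powr (\<beta> - real DIM('a)))))"
proof (cases "x = y")
  \<comment> \<open>On the diagonal a finite maximal function makes the quotient
    \<open>0 / 0\<close>, which is 0 in \<open>ennreal\<close>.\<close>
  case True
  have "(SUP r\<in>{0..R x}. ball_average f x r) < top"
    by (rule local_maximal_finite) (use assms in auto)
  then obtain m where "(SUP r\<in>{0..R x}. ball_average f x r) = ennreal m" "0 \<le> m"
    by (cases "SUP r\<in>{0..R x}. ball_average f x r" rule: ennreal_cases) auto
  then have "local_maximal R f x = ereal m"
    by (simp add: local_maximal_def)
  then show ?thesis
    using True by (simp add: epowr_def e2ennreal_neg)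
next
  case False
  define \<delta> where "\<delta> = norm (x - y)"
  define a where "a = real DIM('a) + \<sigma> * p"
  define D where "D = step_coeff TYPE('a) s p \<kappa> \<Lambda> (\<Lambda> * d powr \<alpha>)"
  let ?e = "energy G s p \<kappa> f"
  have "0 < \<delta>" "0 \<le> D" "\<delta> \<le> d"
    using False assms by (simp_all add: \<delta>_def D_def step_coeff_nonneg)
  have "epowr (e2ennreal \<bar>local_maximal R f x - local_maximal R f y\<bar>) p
      \<le> ennreal (4 powr p) * (ennreal (\<bar>f x - f y\<bar> powr p)
        + ennreal (2 * step_error TYPE('a) s p \<kappa> (\<Lambda> * \<delta> powr \<alpha>)) * (?e x + ?e y))"
    using assms False by (intro local_maximal_diff_powr_le) (auto simp: \<delta>_def dist_norm)
  also have "\<dots> \<le> ennreal (4 powr p) * (ennreal (\<bar>f x - f y\<bar> powr p)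
        + ennreal (2 * D * \<delta> powr (\<alpha> * (s * p - \<kappa>))) * (?e x + ?e y))"
    using step_error_le[of \<Lambda> \<delta> d \<alpha> \<kappa> s p, where ?'a = 'a] assms \<open>0 < \<delta>\<close> \<open>\<delta> \<le> d\<close>
    by (intro mult_left_mono add_left_mono mult_right_mono ennreal_leI) (auto simp: D_def)
  finally have "epowr (e2ennreal \<bar>local_maximal R f x - local_maximal R f y\<bar>) p * ennreal (\<delta> powr (- a))
      \<le> ennreal (4 powr p) * (ennreal (\<bar>f x - f y\<bar> powr p)
        + ennreal (2 * D * \<delta> powr (\<alpha> * (s * p - \<kappa>))) * (?e x + ?e y)) * ennreal (\<delta> powr (- a))"
    by (rule mult_right_mono) simp
  also have "\<dots> = ennreal (4 powr p) * (ennreal (\<bar>f x - f y\<bar> powr p) * ennreal (\<delta> powr (- a))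
        + (ennreal (2 * D * \<delta> powr (\<alpha> * (s * p - \<kappa>))) * ennreal (\<delta> powr (- a))) * (?e x + ?e y))"
    by (simp only: distrib_left distrib_right mult_ac)
  also have "ennreal (2 * D * \<delta> powr (\<alpha> * (s * p - \<kappa>))) * ennreal (\<delta> powr (- a))
      = ennreal (2 * D) * ennreal (\<delta> powr (\<beta> - real DIM('a)))"
  proof -
    have "\<delta> powr (\<alpha> * (s * p - \<kappa>)) * \<delta> powr (- a) = \<delta> powr (\<beta> - real DIM('a))"
      by (simp add: \<beta>_def a_def algebra_simps flip: powr_add)
    then show ?thesis
      using \<open>0 \<le> D\<close> by (simp add: mult.assoc flip: ennreal_mult)
  qed
  also have "ennreal (\<bar>f x - f y\<bar> powr p) * ennreal (\<delta> powr (- a))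
      \<le> ennreal (d powr ((s - \<sigma>) * p)) * ennreal (\<bar>f x - f y\<bar> powr p / \<delta> powr (real DIM('a) + s * p))"
  proof -
    have "\<delta> powr (- a) = \<delta> powr ((s - \<sigma>) * p) * \<delta> powr (- (real DIM('a) + s * p))"
      by (simp add: a_def algebra_simps flip: powr_add)
    also have "\<dots> \<le> d powr ((s - \<sigma>) * p) * \<delta> powr (- (real DIM('a) + s * p))"
      using \<open>0 < \<delta>\<close> \<open>\<delta> \<le> d\<close> assms by (intro mult_right_mono powr_mono2) auto
    finally have "\<bar>f x - f y\<bar> powr p * \<delta> powr (- a)
        \<le> \<bar>f x - f y\<bar> powr p * (d powr ((s - \<sigma>) * p) * \<delta> powr (- (real DIM('a) + s * p)))"
      by (intro mult_left_mono) auto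
    also have "\<dots> = d powr ((s - \<sigma>) * p) * (\<bar>f x - f y\<bar> powr p / \<delta> powr (real DIM('a) + s * p))"
      by (simp only: powr_minus divide_inverse mult_ac)
    finally show ?thesis
      by (simp only: ennreal_mult[symmetric] powr_ge_zero divide_nonneg_nonneg ennreal_leI)
  qed
  also have "epowr (e2ennreal \<bar>local_maximal R f x - local_maximal R f y\<bar>) p * ennreal (\<delta> powr (- a))
      = epowr (e2ennreal \<bar>local_maximal R f x - local_maximal R f y\<bar>) p / ennreal (\<delta> powr a)"
    using \<open>0 < \<delta>\<close> by (simp add: divide_ennreal_def inverse_ennreal powr_minus)
  finally show ?thesis
    by (simp add: \<delta>_def a_def D_def mult_left_mono add_right_mono mult_ac)
qed

subsection \<open>Integration\<close>

lemma nn_integral_energy_le: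
  fixes f :: "'a::euclidean_space \<Rightarrow> real"
  assumes [measurable]: "f \<in> borel_measurable lebesgue" "G \<in> sets lebesgue"
    and K: "\<And>h. h \<in> borel_measurable lebesgue \<Longrightarrow>
      (\<integral>\<^sup>+ x\<in>G. riesz_potential G \<kappa> h x \<partial>lebesgue) \<le> ennreal K * (\<integral>\<^sup>+ x\<in>G. h x \<partial>lebesgue)"
    and "0 \<le> K"
  shows "(\<integral>\<^sup>+ x\<in>G. energy G s p \<kappa> f x \<partial>lebesgue) \<le> ennreal (1 + K) * (\<integral>\<^sup>+ x\<in>G. gagliardo G s p f x \<partial>lebesgue)"
proof -
  have "(\<integral>\<^sup>+ x\<in>G. energy G s p \<kappa> f x \<partial>lebesgue) = (\<integral>\<^sup>+ x\<in>G. gagliardo G s p f x \<partial>lebesgue)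
      + (\<integral>\<^sup>+ x\<in>G. riesz_potential G \<kappa> (gagliardo G s p f) x \<partial>lebesgue)"
    unfolding energy_def distrib_right by (rule nn_integral_add) measurable
  also have "\<dots> \<le> 1 * (\<integral>\<^sup>+ x\<in>G. gagliardo G s p f x \<partial>lebesgue)
      + ennreal K * (\<integral>\<^sup>+ x\<in>G. gagliardo G s p f x \<partial>lebesgue)"
    by (intro add_mono K) simp_all
  also have "\<dots> = ennreal (1 + K) * (\<integral>\<^sup>+ x\<in>G. gagliardo G s p f x \<partial>lebesgue)"
    using \<open>0 \<le> K\<close> by (simp only: ennreal_plus ennreal_1 distrib_right zero_le_one)
  finally show ?thesis .
qed

text \<open>In the y-integral the energy at x meets the integrated kernel, bounded by
  \<open>K\<close>, and the energy at y forms a Riesz potential, whose x-integral costs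
  \<open>K1\<close>. Monotonicity of \<open>nn_integral\<close> holds for arbitrary functions, so no
  measurability of the maximal function has to be proved.\<close>

lemma frac_integral_local_maximal_le:
  fixes f :: "'a::euclidean_space \<Rightarrow> real"
  assumes f [measurable]: "f \<in> borel_measurable lebesgue" and G [measurable]: "G \<in> sets lebesgue"
    and exps: "0 \<le> s" "1 \<le> p" "0 \<le> \<kappa>" "\<kappa> \<le> real DIM('a)" "\<kappa> \<le> s * p" "0 \<le> \<alpha>" "\<sigma> \<le> s"
    and R: "\<And>x. x \<in> G \<Longrightarrow> 0 \<le> R x" "\<And>x. x \<in> G \<Longrightarrow> ball x (R x) \<subseteq> G"
    and "0 \<le> \<Lambda>" and \<Lambda>: "\<And>x y. x \<in> G \<Longrightarrow> y \<in> G \<Longrightarrow> \<bar>R x - R y\<bar> \<le> \<Lambda> * norm (x - y) powr \<alpha>"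
      "\<And>x y. x \<in> G \<Longrightarrow> y \<in> G \<Longrightarrow> norm (x - y) \<le> \<Lambda> * norm (x - y) powr \<alpha>"
    and d: "\<And>x y. x \<in> G \<Longrightarrow> y \<in> G \<Longrightarrow> norm (x - y) \<le> d"
    and fin: "(\<integral>\<^sup>+ x\<in>G. energy G s p \<kappa> f x \<partial>lebesgue) < top"
  defines "\<beta> \<equiv> \<alpha> * (s * p - \<kappa>) - \<sigma> * p"
  assumes K: "\<And>w. w \<in> G \<Longrightarrow> (\<integral>\<^sup>+ x\<in>G. ennreal (norm (x - w) powr (\<beta> - real DIM('a))) \<partial>lebesgue) \<le> ennreal K"
    and K1: "\<And>h. h \<in> borel_measurable lebesgue \<Longrightarrow>
      (\<integral>\<^sup>+ x\<in>G. riesz_potential G \<beta> h x \<partial>lebesgue) \<le> ennreal K1 * (\<integral>\<^sup>+ x\<in>G. h x \<partial>lebesgue)"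
    and "0 \<le> K" "0 \<le> K1"
  shows "(\<integral>\<^sup>+ x\<in>G. (\<integral>\<^sup>+ y\<in>G. epowr (e2ennreal \<bar>local_maximal R f x - local_maximal R f y\<bar>) p
      / ennreal (norm (x - y) powr (real DIM('a) + \<sigma> * p)) \<partial>lebesgue) \<partial>lebesgue)
    \<le> ennreal (4 powr p) * (ennreal (d powr ((s - \<sigma>) * p)) * (\<integral>\<^sup>+ x\<in>G. gagliardo G s p f x \<partial>lebesgue)
      + ennreal (2 * step_coeff TYPE('a) s p \<kappa> \<Lambda> (\<Lambda> * d powr \<alpha>) * (K + K1)) * (\<integral>\<^sup>+ x\<in>G. energy G s p \<kappa> f x \<partial>lebesgue))"
proof -
  define c1 where "c1 = ennreal (d powr ((s - \<sigma>) * p))"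
  define D where "D = 2 * step_coeff TYPE('a) s p \<kappa> \<Lambda> (\<Lambda> * d powr \<alpha>)"
  define c2 where "c2 = ennreal D"
  define k where "k x y = ennreal (norm (x - y) powr (\<beta> - real DIM('a)))" for x y :: 'a
  define q where "q x y = ennreal (\<bar>f x - f y\<bar> powr p / norm (x - y) powr (real DIM('a) + s * p))" for x y
  define e where "e = energy G s p \<kappa> f"
  define F where "F x y = epowr (e2ennreal \<bar>local_maximal R f x - local_maximal R f y\<bar>) p
      / ennreal (norm (x - y) powr (real DIM('a) + \<sigma> * p))" for x y
  have "0 \<le> D"
    by (simp add: D_def step_coeff_nonneg)
  have [measurable]: "e \<in> borel_measurable lebesgue"
    unfolding e_def by measurable
  have [measurable]: "k x \<in> borel_measurable lebesgue" for x
    unfolding k_def by (auto intro!: measurable_completion)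
  have [measurable]: "q x \<in> borel_measurable lebesgue" for x
  proof -
    have [measurable]: "(\<lambda>y. norm (x - y) powr (real DIM('a) + s * p)) \<in> borel_measurable lebesgue"
      by (auto intro!: measurable_completion)
    show ?thesis
      unfolding q_def by measurable
  qed
  have inner: "(\<integral>\<^sup>+ y\<in>G. F x y \<partial>lebesgue)
      \<le> ennreal (4 powr p) * (c1 * gagliardo G s p f x + c2 * (ennreal K * e x + riesz_potential G \<beta> e x))"
    if x: "x \<in> G" "e x < top" for x
  proof -
    have "(\<integral>\<^sup>+ y\<in>G. F x y \<partial>lebesgue)
        \<le> (\<integral>\<^sup>+ y. ennreal (4 powr p) * (c1 * (q x y * indicator G y)
            + c2 * (e x * (k x y * indicator G y) + e y * k x y * indicator G y)) \<partial>lebesgue)"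
    proof (intro nn_integral_mono)
      fix y
      show "F x y * indicator G y \<le> ennreal (4 powr p) * (c1 * (q x y * indicator G y)
            + c2 * (e x * (k x y * indicator G y) + e y * k x y * indicator G y))"
      proof (cases "y \<in> G")
        case True
        have "F x y \<le> ennreal (4 powr p) * (c1 * q x y + c2 * ((e x + e y) * k x y))"
          unfolding F_def c1_def c2_def q_def e_def k_def \<beta>_def D_def
          by (rule local_maximal_quotient_le) (use x True assms in \<open>auto simp: e_def\<close>)
        then show ?thesis
          using True by (simp add: distrib_right)
      qed simp
    qed
    also have "\<dots> = ennreal (4 powr p) * (c1 * (\<integral>\<^sup>+ y\<in>G. q x y \<partial>lebesgue)
            + c2 * (e x * (\<integral>\<^sup>+ y\<in>G. k x y \<partial>lebesgue) + (\<integral>\<^sup>+ y\<in>G. e y * k x y \<partial>lebesgue)))"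
      by (simp add: nn_integral_cmult nn_integral_add)
    also have "(\<integral>\<^sup>+ y\<in>G. q x y \<partial>lebesgue) = gagliardo G s p f x"
      by (simp add: q_def gagliardo_def)
    also have "(\<integral>\<^sup>+ y\<in>G. e y * k x y \<partial>lebesgue) = riesz_potential G \<beta> e x"
      by (simp add: k_def riesz_potential_def)
    also have "e x * (\<integral>\<^sup>+ y\<in>G. k x y \<partial>lebesgue) \<le> ennreal K * e x"
      using K[OF x(1)] by (subst mult.commute) (simp add: k_def norm_minus_commute mult_right_mono)
    finally show ?thesis
      by (simp add: mult_left_mono add_mono)
  qed
  \<comment> \<open>The inner estimate needs finite energy at x; the finite integral provides this
    almost everywhere on \<open>G\<close>.\<close>
  have "AE x in lebesgue. e x * indicator G x \<noteq> \<infinity>"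
    using fin by (intro nn_integral_PInf_AE) (auto simp: e_def)
  then have "(\<integral>\<^sup>+ x\<in>G. (\<integral>\<^sup>+ y\<in>G. F x y \<partial>lebesgue) \<partial>lebesgue)
      \<le> (\<integral>\<^sup>+ x. ennreal (4 powr p) * (c1 * (gagliardo G s p f x * indicator G x)
        + c2 * (ennreal K * (e x * indicator G x) + riesz_potential G \<beta> e x * indicator G x)) \<partial>lebesgue)"
  proof (intro nn_integral_mono_AE, eventually_elim)
    case (elim x)
    then show ?case
      using inner[of x] by (cases "x \<in> G") (simp_all add: less_top)
  qed
  also have "\<dots> = ennreal (4 powr p) * (c1 * (\<integral>\<^sup>+ x\<in>G. gagliardo G s p f x \<partial>lebesgue)
        + c2 * (ennreal K * (\<integral>\<^sup>+ x\<in>G. e x \<partial>lebesgue) + (\<integral>\<^sup>+ x\<in>G. riesz_potential G \<beta> e x \<partial>lebesgue)))"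
    by (simp add: nn_integral_cmult nn_integral_add)
  also have "\<dots> \<le> ennreal (4 powr p) * (c1 * (\<integral>\<^sup>+ x\<in>G. gagliardo G s p f x \<partial>lebesgue)
        + c2 * (ennreal K * (\<integral>\<^sup>+ x\<in>G. e x \<partial>lebesgue) + ennreal K1 * (\<integral>\<^sup>+ x\<in>G. e x \<partial>lebesgue)))"
    by (intro mult_left_mono add_left_mono K1) simp_all
  also have "c2 * (ennreal K * (\<integral>\<^sup>+ x\<in>G. e x \<partial>lebesgue) + ennreal K1 * (\<integral>\<^sup>+ x\<in>G. e x \<partial>lebesgue))
      = ennreal (D * (K + K1)) * (\<integral>\<^sup>+ x\<in>G. e x \<partial>lebesgue)"
    using \<open>0 \<le> D\<close> \<open>0 \<le> K\<close> \<open>0 \<le> K1\<close>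
    by (simp only: c2_def ennreal_mult ennreal_plus distrib_right mult.assoc add_nonneg_nonneg)
  finally show ?thesis
    by (simp only: F_def e_def c1_def D_def)
qed

section \<open>The seminorm via the density, and values outside G\<close>

lemma frac_seminorm_eq_gagliardo:
  fixes f :: "'a::euclidean_space \<Rightarrow> real"
  shows "frac_seminorm G s p (\<lambda>x. ereal (f x)) = epowr (\<integral>\<^sup>+ x\<in>G. gagliardo G s p f x \<partial>lebesgue) (1 / p)"
proof -
  have "epowr (e2ennreal \<bar>ereal (f x) - ereal (f y)\<bar>) p / ennreal (norm (x - y) powr (real DIM('a) + s * p))
      = ennreal (\<bar>f x - f y\<bar> powr p / norm (x - y) powr (real DIM('a) + s * p))" for x y
    by (cases "x = y") (simp_all add: e2ennreal_ereal epowr_ennreal divide_ennreal e2ennreal_neg epowr_def)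
  then show ?thesis
    by (simp add: frac_seminorm_def gagliardo_def)
qed

text \<open>All balls involved lie in \<open>G\<close>. This permits replacing f by its extension by
  zero.\<close>

lemma local_maximal_cong:
  assumes "\<And>y. y \<in> G \<Longrightarrow> f y = g y" "x \<in> G" "ball x (R x) \<subseteq> G"
  shows "local_maximal R f x = local_maximal R g x"
proof -
  have "ball_average f x r = ball_average g x r" if "r \<in> {0..R x}" for r
  proof -
    have "ball x r \<subseteq> G"
      using that assms(3) subset_ball[of r "R x" x] by auto
    then have "(\<integral>\<^sup>+ y\<in>ball x r. ennreal \<bar>f y\<bar> \<partial>lebesgue) = (\<integral>\<^sup>+ y\<in>ball x r. ennreal \<bar>g y\<bar> \<partial>lebesgue)"
      using assms(1) by (intro nn_integral_cong) (auto simp: indicator_def)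
    then show ?thesis
      using assms by (simp add: ball_average_def)
  qed
  then show ?thesis
    by (simp add: local_maximal_def)
qed

lemma frac_seminorm_cong:
  assumes "\<And>x. x \<in> G \<Longrightarrow> F x = H x"
  shows "frac_seminorm G t p F = frac_seminorm G t p H"
  unfolding frac_seminorm_def using assms
  by (intro arg_cong2[where f = epowr] nn_integral_cong refl) (auto simp: indicator_def intro!: nn_integral_cong)

lemma diameter_open_pos:
  fixes G :: "'a::euclidean_space set"
  assumes "open G" "bounded G" "G \<noteq> {}"
  shows "0 < diameter G"
proof -
  obtain x r where "0 < r" "ball x r \<subseteq> G"
    using assms by (metis all_not_in_conv open_contains_ball)
  then show ?thesis
    using diameter_subset[of "ball x r" G] assms by simp
qed

theorem corollary5p6:
  fixes \<sigma> s \<alpha> p L d :: real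
  assumes "0 < s" "s < 1" "0 < \<alpha>" "\<alpha> < 1" "1 < p"
    and "0 < \<sigma>" "\<sigma> < \<alpha> * s"
  shows "\<exists>C::real. C > 0 \<and>
    (\<forall>(G :: (real ^ 'n) set) R.
       G \<noteq> {} \<longrightarrow> bounded G \<longrightarrow> open G \<longrightarrow> diameter G = d \<longrightarrow>
       holder_on \<alpha> L R G \<longrightarrow>
       (\<forall>x\<in>G. 0 \<le> R x \<and> R x \<le> infdist x (frontier G)) \<longrightarrow>
       (\<forall>f \<in> Lp_on p G.
          frac_seminorm G \<sigma> p (local_maximal R f)
            \<le> ennreal C * frac_seminorm G s p (\<lambda>x. ereal (f x))))"
proof (cases "0 \<le> L \<and> 0 < d")
  \<comment> \<open>No \<open>G\<close> and \<open>R\<close> satisfy the hypotheses here, so any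
    positive constant will do.\<close>
  case False
  then show ?thesis
    by (intro exI[of _ 1]) (auto simp: holder_on_def dest: diameter_open_pos)
next
  case True
  then have "0 \<le> L" "0 < d"
    by auto
  let ?n = "real DIM(real ^ 'n)"
  \<comment> \<open>The bound 1 keeps \<kappa> \<le> n, and \<kappa> < p (s - \<sigma>/\<alpha>) is
    equivalent to \<beta> > 0. Such a positive \<kappa> exists because \<sigma> < \<alpha>
    s.\<close>
  define \<kappa> where "\<kappa> = min 1 (p * (s - \<sigma> / \<alpha>) / 2)"
  define \<beta> where "\<beta> = \<alpha> * (s * p - \<kappa>) - \<sigma> * p"
  \<comment> \<open>The summand L handles |R x - R y|; the other handles |x - y| = |x -
    y|^(1-\<alpha>) |x - y|^\<alpha>. Thus \<theta> = \<Lambda> |x - y|^\<alpha> bounds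
    both.\<close>
  define \<Lambda> where "\<Lambda> = L + d powr (1 - \<alpha>)"
  have "0 < p * (s - \<sigma> / \<alpha>)"
    using assms by (simp add: field_simps)
  moreover have "0 < min 1 (q / 2) \<and> min 1 (q / 2) \<le> 1 \<and> min 1 (q / 2) < q" if "0 < q" for q :: real
    using that by auto
  ultimately have "0 < \<kappa>" "\<kappa> \<le> 1" "\<kappa> < p * (s - \<sigma> / \<alpha>)"
    unfolding \<kappa>_def by blast+
  moreover have "p * (s - \<sigma> / \<alpha>) \<le> s * p"
    using assms by (simp add: field_simps)
  moreover have "1 \<le> ?n"
    using DIM_positive[where 'a = "real ^ 'n"] by linarith
  ultimately have \<kappa>: "0 < \<kappa>" "\<kappa> \<le> ?n" "\<kappa> \<le> s * p"
    by linarith+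
  have "\<alpha> * \<kappa> < \<alpha> * (p * (s - \<sigma> / \<alpha>))"
    using \<open>\<kappa> < p * (s - \<sigma> / \<alpha>)\<close> \<open>0 < \<alpha>\<close> by simp
  also have "\<dots> = \<alpha> * (s * p) - \<sigma> * p"
    using \<open>0 < \<alpha>\<close> by (simp add: field_simps)
  finally have "0 < \<beta>"
    by (simp add: \<beta>_def algebra_simps)
  have "\<sigma> \<le> s"
    using assms mult_right_mono[of \<alpha> 1 s] by linarith
  have "0 \<le> \<Lambda>"
    using \<open>0 \<le> L\<close> by (simp add: \<Lambda>_def)
  \<comment> \<open>This bound and the next two, for potentials of orders \<beta> and \<kappa>, are
    fixed before \<open>G\<close>, \<open>R\<close> and \<open>f\<close>.\<close>
  obtain K where "0 \<le> K" and K: "\<And>(G :: (real ^ 'n) set) w. (\<forall>x\<in>G. dist w x \<le> d) \<Longrightarrow>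
      (\<integral>\<^sup>+ x\<in>G. ennreal (norm (x - w) powr (\<beta> - ?n)) \<partial>lebesgue) \<le> ennreal K"
    using nn_integral_riesz_kernel_le[OF \<open>0 < d\<close> \<open>0 < \<beta>\<close>, where ?'a = "real ^ 'n"] by blast
  obtain K1 where "0 \<le> K1" and K1: "\<And>(G :: (real ^ 'n) set) h. G \<in> sets lebesgue \<Longrightarrow>
      h \<in> borel_measurable lebesgue \<Longrightarrow> (\<forall>x\<in>G. \<forall>y\<in>G. dist x y \<le> d) \<Longrightarrow>
      (\<integral>\<^sup>+ x\<in>G. riesz_potential G \<beta> h x \<partial>lebesgue) \<le> ennreal K1 * (\<integral>\<^sup>+ w\<in>G. h w \<partial>lebesgue)"
    using nn_integral_riesz_potential_le[OF \<open>0 < d\<close> \<open>0 < \<beta>\<close>, where ?'a = "real ^ 'n"] by blast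
  obtain K2 where "0 \<le> K2" and K2: "\<And>(G :: (real ^ 'n) set) h. G \<in> sets lebesgue \<Longrightarrow>
      h \<in> borel_measurable lebesgue \<Longrightarrow> (\<forall>x\<in>G. \<forall>y\<in>G. dist x y \<le> d) \<Longrightarrow>
      (\<integral>\<^sup>+ x\<in>G. riesz_potential G \<kappa> h x \<partial>lebesgue) \<le> ennreal K2 * (\<integral>\<^sup>+ w\<in>G. h w \<partial>lebesgue)"
    using nn_integral_riesz_potential_le[OF \<open>0 < d\<close> \<open>0 < \<kappa>\<close>, where ?'a = "real ^ 'n"] by blast
  define D where "D = 2 * step_coeff TYPE(real ^ 'n) s p \<kappa> \<Lambda> (\<Lambda> * d powr \<alpha>) * (K + K1)"
  define C where "C = 4 powr p * (d powr ((s - \<sigma>) * p) + D * (1 + K2))"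
  have "0 \<le> D"
    using \<open>0 \<le> K\<close> \<open>0 \<le> K1\<close> by (simp add: D_def step_coeff_nonneg)
  then have "0 < C"
    using \<open>0 < d\<close> \<open>0 \<le> K2\<close> by (simp add: C_def add_pos_nonneg)
  have "frac_seminorm G \<sigma> p (local_maximal R f)
            \<le> ennreal (C powr (1 / p)) * frac_seminorm G s p (\<lambda>x. ereal (f x))"
    if "bounded G" "open G" "diameter G = d" and holder: "holder_on \<alpha> L R G"
      and R: "\<forall>x\<in>G. 0 \<le> R x \<and> R x \<le> infdist x (frontier G)" and f: "f \<in> Lp_on p G"
    for G :: "(real ^ 'n) set" and R f
  proof -
    \<comment> \<open>f is measurable on \<open>G\<close> only; its extension by zero is Lebesgue
      measurable on the whole space.\<close>
    define g where "g x = (if x \<in> G then f x else 0)" for x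
    have [measurable]: "G \<in> sets lebesgue"
      using \<open>open G\<close> by (simp add: borel_open)
    have [measurable]: "g \<in> borel_measurable lebesgue"
      unfolding g_def using f by (intro borel_measurable_if_I) (auto simp: Lp_on_def)
    have dG: "dist x y \<le> d" if "x \<in> G" "y \<in> G" for x y
      using diameter_bounded_bound[OF \<open>bounded G\<close> that] \<open>diameter G = d\<close> by simp
    have ball: "ball x (R x) \<subseteq> G" if "x \<in> G" for x
      using that R by (intro ball_infdist_frontier_subset) auto
    let ?I = "\<integral>\<^sup>+ x\<in>G. gagliardo G s p g x \<partial>lebesgue"
    let ?J = "\<integral>\<^sup>+ x\<in>G. energy G s p \<kappa> g x \<partial>lebesgue"
    have J: "?J \<le> ennreal (1 + K2) * ?I"
      using \<open>0 \<le> K2\<close> dG by (intro nn_integral_energy_le K2) auto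
    have "frac_seminorm G \<sigma> p (local_maximal R g)
            \<le> ennreal (C powr (1 / p)) * frac_seminorm G s p (\<lambda>x. ereal (g x))"
    proof (cases "?I < top")
      \<comment> \<open>The right side is infinite, since its constant is positive.\<close>
      case False
      then show ?thesis
        using \<open>0 < C\<close> by (simp add: frac_seminorm_eq_gagliardo less_top[symmetric] ennreal_mult_top)
    next
      case True
      then have "ennreal (1 + K2) * ?I < top"
        by (simp add: ennreal_mult_less_top)
      with J have "?J < top"
        by (rule le_less_trans)
      have "(\<integral>\<^sup>+ x\<in>G. (\<integral>\<^sup>+ y\<in>G. epowr (e2ennreal \<bar>local_maximal R g x - local_maximal R g y\<bar>) p
          / ennreal (norm (x - y) powr (?n + \<sigma> * p)) \<partial>lebesgue) \<partial>lebesgue)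
        \<le> ennreal (4 powr p) * (ennreal (d powr ((s - \<sigma>) * p)) * ?I + ennreal D * ?J)"
        unfolding D_def
      proof (rule frac_integral_local_maximal_le)
        show "\<bar>R x - R y\<bar> \<le> \<Lambda> * norm (x - y) powr \<alpha>" if "x \<in> G" "y \<in> G" for x y
        proof -
          have "\<bar>R x - R y\<bar> \<le> L * norm (x - y) powr \<alpha>"
            using holder that by (auto simp: holder_on_def)
          also have "\<dots> \<le> \<Lambda> * norm (x - y) powr \<alpha>"
            by (intro mult_right_mono) (auto simp: \<Lambda>_def)
          finally show ?thesis .
        qed
        show "norm (x - y) \<le> \<Lambda> * norm (x - y) powr \<alpha>" if "x \<in> G" "y \<in> G" for x y
        proof -
          have "norm (x - y) = norm (x - y) powr (1 - \<alpha>) * norm (x - y) powr \<alpha>"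
            by (simp flip: powr_add)
          also have "\<dots> \<le> \<Lambda> * norm (x - y) powr \<alpha>"
            using dG[OF that] \<open>0 \<le> L\<close> \<open>\<alpha> < 1\<close>
            by (intro mult_right_mono) (auto simp: \<Lambda>_def dist_norm intro!: add_increasing powr_mono2)
          finally show ?thesis .
        qed
        show "norm (x - y) \<le> d" if "x \<in> G" "y \<in> G" for x y
          using dG[OF that] by (simp add: dist_norm)
        show "(\<integral>\<^sup>+ x\<in>G. ennreal (norm (x - w) powr (\<alpha> * (s * p - \<kappa>) - \<sigma> * p - ?n)) \<partial>lebesgue) \<le> ennreal K" if "w \<in> G" for w
          using K[of G w] dG that by (simp add: \<beta>_def)
        show "(\<integral>\<^sup>+ x\<in>G. riesz_potential G (\<alpha> * (s * p - \<kappa>) - \<sigma> * p) h x \<partial>lebesgue) \<le> ennreal K1 * (\<integral>\<^sup>+ x\<in>G. h x \<partial>lebesgue)"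
          if "h \<in> borel_measurable lebesgue" for h
          using K1[of G h] dG that by (simp add: \<beta>_def)
      qed (use assms \<kappa> ball R \<open>\<sigma> \<le> s\<close> \<open>0 \<le> \<Lambda>\<close> \<open>0 \<le> K\<close> \<open>0 \<le> K1\<close> \<open>?J < top\<close> in auto)
      also have "\<dots> \<le> ennreal (4 powr p) * (ennreal (d powr ((s - \<sigma>) * p)) * ?I + ennreal D * (ennreal (1 + K2) * ?I))"
        using J by (intro mult_left_mono add_left_mono) auto
      also have "\<dots> = ennreal C * ?I"
        using \<open>0 \<le> D\<close> \<open>0 \<le> K2\<close>
        by (simp only: C_def ennreal_mult ennreal_plus distrib_right mult.assoc add_nonneg_nonneg mult_nonneg_nonneg powr_ge_zero zero_le_one)
      finally have "frac_seminorm G \<sigma> p (local_maximal R g) \<le> epowr (ennreal C * ?I) (1 / p)"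
        unfolding frac_seminorm_def using \<open>1 < p\<close> by (intro epowr_mono) auto
      also have "\<dots> = ennreal (C powr (1 / p)) * frac_seminorm G s p (\<lambda>x. ereal (g x))"
        using \<open>0 < C\<close> by (simp add: epowr_cmult frac_seminorm_eq_gagliardo)
      finally show ?thesis .
    qed
    moreover have "frac_seminorm G \<sigma> p (local_maximal R g) = frac_seminorm G \<sigma> p (local_maximal R f)"
      by (intro frac_seminorm_cong local_maximal_cong[where G = G] ball) (auto simp: g_def)
    moreover have "frac_seminorm G s p (\<lambda>x. ereal (g x)) = frac_seminorm G s p (\<lambda>x. ereal (f x))"
      by (intro frac_seminorm_cong) (simp add: g_def)
    ultimately show ?thesis
      by simp
  qed
  then show ?thesis
    using \<open>0 < C\<close> by (intro exI[of _ "C powr (1 / p)"]) auto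
qed

end
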